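(* Let $\Omega\subset\mathbb{R}$ be open, let $N:\Omega\to\mathbb{R}$ be smooth ($C^\infty$), let $u^0\in\Omega$, and let $u:(T_\star,T^\star)\to\Omega$, with $-\infty\leq T_\star<0<T^\star\leq+\infty$, be the maximal solution of $u'(t)=N(u(t))u(t)$, $u(0)=u^0$. Let $T\in(0,T^\star)$. Let $s\geq 1$ and suppose that $(c_i)_{1\leq i\leq s}$ with $0\leq c_1<\dots<c_s\leq 1$, $(a_{i,j})_{1\leq i,j\leq s}$ and $(b_i)_{1\leq i\leq s}$ are the coefficients of a Runge--Kutta collocation method of order $s$, and that $D\in\mathcal{M}_s(\mathbb{R})$ and $(\theta_1,\dots,\theta_s)\in\mathbb{R}^s$ define a step that is strongly stable and of order $s$. Fix $r>0$ such that $$V=\{u(t)+v \mid t\in[0,T],\ v\in\mathbb{R},\ |v|\leq r\}\subset\Omega,$$ set $M=\sup_{t\in[0,T]}|N(u(t))|$ and fix $m>0$ such that $M+m>\sup_{v\in V}|N(v)|$. Then there exist constants $C>0$ and $h_0>0$, with $h_0<-T_\star$ and $Ce^{CT}h_0^s<\min\{r,m\}$, such that the following holds for all $h\in(0,h_0)$. Let $u_0\in\Omega$ and $(\gamma_{-1+c_1},\dots,\gamma_{-1+c_s})\in N(V)^s$ satisfy $$e^{CT}\Big(|u^0-u_0|+C\Big(\max_{1\leq i\leq s}|\gamma_{-1+c_i}-N(u(t_{-1}+c_ih))|+h_0^s\Big)\Big)<r$$ and $$Ce^{CT}\Big(|u^0-u_0|+\max_{1\leq i\leq s}|\gamma_{-1+c_i}-N(u(t_{-1}+c_ih))|+h_0^s\Big)<m.$$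 Then, for all $n\in\mathbb{N}$ such that $t_{n-1}\leq T$, the linear system $$u_{n,i}=u_n+h\sum_{j=1}^s a_{i,j}\,\gamma_{n+c_j}\,u_{n,j},\qquad 1\leq i\leq s,$$ has a unique solution $(u_{n,i})_{1\leq i\leq s}$ in $\mathbb{R}^s$, and for all $n\in\mathbb{N}$ such that $t_n\leq T$, $$|\gamma_{n-1+c_i}|\leq M+m\qquad\text{for all } i\in\{1,\dots,s\},$$ $$\max_{0\leq k\leq n}|u(t_k)-u_k|\leq e^{Cnh}\Big[|u^0-u_0|+C\Big(\max_{1\leq i\leq s}|\gamma_{-1+c_i}-N(u(t_{-1}+c_ih))|+h^s\Big)\Big].$$
   Context: Notation: $t_n=nh$ for integers $n\geq -1$; $u^0$ (superscript) is the exact initial datum and $u_0$ (subscript) the numerical one; $N(V)=\{N(v) : v\in V\}$; $\mathbb{N}$ contains $0$. Numerical method. Starting from $u_0$ and $(\gamma_{-1+c_i})_{1\leq i\leq s}$, for $n=0,1,2,\dots$ one computes successively: (1) $(\gamma_{n+c_1},\dots,\gamma_{n+c_s})^T=D(\gamma_{n-1+c_1},\dots,\gamma_{n-1+c_s})^T+(\theta_1,\dots,\theta_s)^T N(u_n)$ (this update is "the step" defined by $D$ and $(\theta_i)$); (2) $(u_{n,i})_{1\leq i\leq s}$ as the solution of $u_{n,i}=u_n+h\sum_{j=1}^s a_{i,j}\gamma_{n+c_j}u_{n,j}$, $1\leq i\leq s$; (3) $u_{n+1}=u_n+h\sum_{i=1}^s b_i\gamma_{n+c_i}u_{n,i}$.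 The assertion that the system in (2) has a unique solution at index $n$ includes that the quantities $u_n$ and $\gamma_{n+c_j}$ entering it are well defined by the recursion (in particular $u_n\in\Omega$). Runge--Kutta collocation method: $a_{i,j}=\int_0^{c_i}\mathcal{L}_j(\tau)\,d\tau$ and $b_i=\int_0^1\mathcal{L}_i(\tau)\,d\tau$, where $\mathcal{L}_i(\tau)=\prod_{k\neq i}\frac{\tau-c_k}{c_i-c_k}$ are the Lagrange polynomials at $c_1,\dots,c_s$. "Of order $s$" is understood as order at least $s$ (local error $O(h^{s+1})$ for smooth ODEs), which holds for collocation at $s$ distinct nodes. Strong stability of the step: $\rho(D)<1$, where $\rho(D)$ is the spectral radius of $D$ (largest modulus of its complex eigenvalues). Order $s$ of the step: for $h>0$ define the $s\times s$ matrices $(V_c^h)_{ij}=(c_ih)^{j-1}$, $(V_{c-1}^h)_{ij}=((c_i-1)h)^{j-1}$ (with $0^0=1$), and $\Theta$ with $(\Theta)_{i1}=\theta_i$, $(\Theta)_{ij}=0$ for $j\geq2$. The step is (consistent) of order $s$ if $V_c^h=D\,V_{c-1}^h+\Theta$ for all $h>0$. *)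

theory Defs
  imports "HOL-Analysis.Analysis" "Jordan_Normal_Form.Spectral_Radius"
begin

text \<open>Vectors of \<open>\<real>\<^sup>s\<close> and \<open>s \<times> s\<close> matrices are elements of \<^term>\<open>carrier_vec s\<close> and
  \<^term>\<open>carrier_mat s s\<close>. They are indexed from \<open>0\<close>, so that the mathematical indices
  \<open>1, \<dots>, s\<close> become \<open>0, \<dots>, s - 1\<close>. Below, \<open>$\<close> always denotes indexing of such vectors.\<close>

unbundle no vec_syntax

notation vec_index (infixl "$" 100)

text \<open>On an open set, iterated \<^term>\<open>deriv\<close> is the usual higher derivative.\<close>

definition smooth_on_open :: "real set \<Rightarrow> (real \<Rightarrow> real) \<Rightarrow> bool" where
  "smooth_on_open S f \<longleftrightarrow> open S \<and> (\<forall>k. (deriv ^^ k) f differentiable_on S)"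

definition ode_solution ::
    "real set \<Rightarrow> (real \<Rightarrow> real) \<Rightarrow> real \<Rightarrow> ereal \<Rightarrow> ereal \<Rightarrow> (real \<Rightarrow> real) \<Rightarrow> bool" where
  "ode_solution \<Omega> N x0 a b u \<longleftrightarrow>
     a < 0 \<and> 0 < b \<and> u 0 = x0 \<and>
     (\<forall>t\<in>einterval a b. u t \<in> \<Omega> \<and> (u has_real_derivative N (u t) * u t) (at t))"

definition maximal_ode_solution ::
    "real set \<Rightarrow> (real \<Rightarrow> real) \<Rightarrow> real \<Rightarrow> ereal \<Rightarrow> ereal \<Rightarrow> (real \<Rightarrow> real) \<Rightarrow> bool" where
  "maximal_ode_solution \<Omega> N x0 a b u \<longleftrightarrow>
     ode_solution \<Omega> N x0 a b u \<and>
     (\<forall>a' b' v. a' \<le> a \<and> b \<le> b' \<and> ode_solution \<Omega> N x0 a' b' v \<and>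
        (\<forall>t\<in>einterval a b. v t = u t) \<longrightarrow> a' = a \<and> b' = b)"

definition lagrange_basis :: "nat \<Rightarrow> real vec \<Rightarrow> nat \<Rightarrow> real \<Rightarrow> real" where
  "lagrange_basis s c i \<tau> = (\<Prod>k\<in>{..<s} - {i}. (\<tau> - c $ k) / (c $ i - c $ k))"

text \<open>Coefficients of the Runge--Kutta collocation method at the distinct nodes \<open>c\<close>. Such a method
  automatically has order at least \<open>s\<close>, so the order is not a separate requirement.\<close>

definition rk_collocation :: "nat \<Rightarrow> real vec \<Rightarrow> real mat \<Rightarrow> real vec \<Rightarrow> bool" where
  "rk_collocation s c A b \<longleftrightarrow>
     c \<in> carrier_vec s \<and> A \<in> carrier_mat s s \<and> b \<in> carrier_vec s \<and>
     (\<forall>i<s. 0 \<le> c $ i \<and> c $ i \<le> 1) \<and>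
     (\<forall>i j. i < j \<and> j < s \<longrightarrow> c $ i < c $ j) \<and>
     (\<forall>i<s. \<forall>j<s. A $$ (i, j) = integral {0..c $ i} (lagrange_basis s c j)) \<and>
     (\<forall>i<s. b $ i = integral {0..1} (lagrange_basis s c i))"

definition strongly_stable_step :: "real mat \<Rightarrow> bool" where
  "strongly_stable_step D \<longleftrightarrow> spectral_radius (map_mat complex_of_real D) < 1"

definition step_of_order :: "nat \<Rightarrow> real vec \<Rightarrow> real mat \<Rightarrow> real vec \<Rightarrow> bool" where
  "step_of_order s c D \<theta> \<longleftrightarrow>
     (\<forall>h>0. Matrix.mat s s (\<lambda>(i, j). (c $ i * h) ^ j) =
        D * Matrix.mat s s (\<lambda>(i, j). ((c $ i - 1) * h) ^ j)
        + Matrix.mat s s (\<lambda>(i, j). if j = 0 then \<theta> $ i else 0))"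

definition step_update ::
    "(real \<Rightarrow> real) \<Rightarrow> real mat \<Rightarrow> real vec \<Rightarrow> real \<Rightarrow> real vec \<Rightarrow> real vec" where
  "step_update N D \<theta> x g = D *\<^sub>v g + N x \<cdot>\<^sub>v \<theta>"

definition stage_solution ::
    "nat \<Rightarrow> real mat \<Rightarrow> real \<Rightarrow> real \<Rightarrow> real vec \<Rightarrow> real vec \<Rightarrow> bool" where
  "stage_solution s A h x g w \<longleftrightarrow>
     w \<in> carrier_vec s \<and> (\<forall>i<s. w $ i = x + h * (\<Sum>j<s. A $$ (i, j) * g $ j * w $ j))"

text \<open>The state at index \<open>n\<close> is the pair of \<open>u\<^sub>n\<close> and the vector \<open>(\<gamma>\<^bsub>n-1+c_i\<^esub>)\<^sub>i\<close>; the latter lags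
  one step behind. The recursion is totalised by \<open>THE\<close> and by evaluating \<open>N\<close> outside \<open>\<Omega>\<close>; its values
  are meaningful up to index \<open>n\<close> only when, at all previous indices, \<open>u\<close> lies in \<open>\<Omega>\<close> and the
  stage system has a unique solution (see \<open>scheme_well_defined\<close> below).\<close>

primrec scheme_state ::
    "nat \<Rightarrow> (real \<Rightarrow> real) \<Rightarrow> real mat \<Rightarrow> real vec \<Rightarrow> real mat \<Rightarrow> real vec \<Rightarrow> real \<Rightarrow>
     real \<Rightarrow> real vec \<Rightarrow> nat \<Rightarrow> real \<times> real vec" where
  "scheme_state s N A b D \<theta> h x0 g0 0 = (x0, g0)"
| "scheme_state s N A b D \<theta> h x0 g0 (Suc n) =
     (let (x, g) = scheme_state s N A b D \<theta> h x0 g0 n;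
          g' = step_update N D \<theta> x g;
          w = (THE w. stage_solution s A h x g' w)
      in (x + h * (\<Sum>i<s. b $ i * g' $ i * w $ i), g'))"

definition scheme_u ::
    "nat \<Rightarrow> (real \<Rightarrow> real) \<Rightarrow> real mat \<Rightarrow> real vec \<Rightarrow> real mat \<Rightarrow> real vec \<Rightarrow> real \<Rightarrow>
     real \<Rightarrow> real vec \<Rightarrow> nat \<Rightarrow> real" where
  "scheme_u s N A b D \<theta> h x0 g0 n = fst (scheme_state s N A b D \<theta> h x0 g0 n)"

text \<open>\<open>scheme_gamma_prev \<dots> n\<close> is \<open>(\<gamma>\<^bsub>n-1+c_i\<^esub>)\<^sub>i\<close>.\<close>

definition scheme_gamma_prev ::
    "nat \<Rightarrow> (real \<Rightarrow> real) \<Rightarrow> real mat \<Rightarrow> real vec \<Rightarrow> real mat \<Rightarrow> real vec \<Rightarrow> real \<Rightarrow>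
     real \<Rightarrow> real vec \<Rightarrow> nat \<Rightarrow> real vec" where
  "scheme_gamma_prev s N A b D \<theta> h x0 g0 n = snd (scheme_state s N A b D \<theta> h x0 g0 n)"

text \<open>The stage system at index \<open>n\<close>, whose coefficients are \<open>\<gamma>\<^bsub>n+c_j\<^esub>\<close>, is well posed; this includes
  that \<open>u\<^sub>k\<close> and \<open>\<gamma>\<^bsub>k+c_j\<^esub>\<close> are well defined for all \<open>k \<le> n\<close>.\<close>

definition scheme_well_defined ::
    "real set \<Rightarrow> nat \<Rightarrow> (real \<Rightarrow> real) \<Rightarrow> real mat \<Rightarrow> real vec \<Rightarrow> real mat \<Rightarrow> real vec \<Rightarrow> real \<Rightarrow>
     real \<Rightarrow> real vec \<Rightarrow> nat \<Rightarrow> bool" where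
  "scheme_well_defined \<Omega> s N A b D \<theta> h x0 g0 n \<longleftrightarrow>
     (\<forall>k\<le>n. scheme_u s N A b D \<theta> h x0 g0 k \<in> \<Omega> \<and>
        (\<exists>!w. stage_solution s A h (scheme_u s N A b D \<theta> h x0 g0 k)
                (scheme_gamma_prev s N A b D \<theta> h x0 g0 (Suc k)) w))"

text \<open>The initial error \<open>max\<^sub>i \<bar>\<gamma>\<^bsub>-1+c_i\<^esub> - N(u(t\<^bsub>-1\<^esub> + c\<^sub>i h))\<bar>\<close>, where \<open>t\<^bsub>-1\<^esub> = -h\<close>.\<close>

definition gamma_init_error ::
    "nat \<Rightarrow> (real \<Rightarrow> real) \<Rightarrow> (real \<Rightarrow> real) \<Rightarrow> real vec \<Rightarrow> real \<Rightarrow> real vec \<Rightarrow> real" where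
  "gamma_init_error s N u c h g0 = (MAX i\<in>{..<s}. \<bar>g0 $ i - N (u (- h + c $ i * h))\<bar>)"

end

theory Submission
  imports Defs
begin

text \<open>The scheme is compared with the exact values \<open>u(t\<^sub>n)\<close> and \<open>N(u(t\<^bsub>n-1\<^esub> + c\<^sub>i h))\<close>. Let \<open>E\<^sub>n\<close> be the error
  of \<open>u\<^sub>n\<close> and \<open>e\<^sub>n\<close> the vector of the errors of \<open>\<gamma>\<^bsub>n-1+c_i\<^esub>\<close>. Consistency yields two coupled recursions,
  of the form
  \<open>e\<^bsub>n+1\<^esub> = D e\<^sub>n + O(E\<^sub>n + h\<^sup>s)\<close> and \<open>E\<^bsub>n+1\<^esub> \<le> (1 + O(h)) E\<^sub>n + O(h) \<bar>e\<^bsub>n+1\<^esub>\<bar> + O(h\<^bsup>s+1\<^esup>)\<close>.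
  In the first one, the order condition makes the step exact on the Taylor polynomial of \<open>N \<circ> u\<close> of degree
  less than \<open>s\<close> (\<open>step_consistency\<close>). In the second one, the collocation weights integrate polynomials
  of degree less than \<open>s\<close> exactly, so the exact solution satisfies the Runge--Kutta equations up to
  \<open>h\<^bsup>s+1\<^esup>\<close> (\<open>collocation_consistency\<close>), and for small \<open>h\<close> the stage system is a contraction that transports
  such defects with bounded constants (\<open>rk_step_perturbation\<close>).

  The first recursion carries no factor \<open>h\<close> in front of its source term, so summing it over \<open>O(1/h)\<close> steps
  would lose one power of \<open>h\<close>. Strong stability prevents this: \<open>D\<close> contracts by a factor \<open>q < 1\<close> in a
  suitable norm (\<open>adapted_norm_exists\<close>), so old errors are forgotten and \<open>e\<^sub>n\<close> stays below a fixed
  multiple \<open>L\<close> of the current bound for \<open>E\<^sub>n\<close>. Consequently one geometric sequence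
  \<open>B\<^sub>n = (1 + growth h)\<^sup>n (E\<^sub>0 + \<epsilon>\<^sub>0 + h\<^sup>s)\<close>, with \<open>\<epsilon>\<^sub>0\<close> the initial error of the \<open>\<gamma>\<close>'s, controls both errors,
  \<open>E\<^sub>n \<le> B\<^sub>n\<close> and \<open>\<bar>e\<^sub>n\<bar> \<le> L B\<^sub>n\<close>, and this is proved by a single induction (\<open>one_step\<close>, \<open>scheme_error\<close>).

  The induction must also keep \<open>u\<^sub>n\<close> in the tube of radius \<open>r\<close>, where \<open>N\<close> is Lipschitz, and the \<open>\<gamma>\<close>'s bounded,
  since the solvability of the stage system depends on their size. The two smallness hypotheses on the
  initial errors ensure that the final value of \<open>B\<^sub>n\<close> is less than \<open>r\<close> and that \<open>L B\<^sub>n\<close> is less than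
  \<open>m\<close>, provided that \<open>C\<close> dominates both \<open>L\<close> and the growth rate. The last step to be controlled may begin
  after \<open>T\<close>, so the estimates are carried out up to a time \<open>T' > T\<close> over which the tube still lies in \<open>\<Omega>\<close>;
  enlarging \<open>C\<close> by the factor \<open>T' / T\<close> makes up for the longer time.\<close>

section \<open>Derivatives along the exact solution\<close>

text \<open>Finite-order differentiability with an existentially quantified derivative. Since the derivative is
  not the term \<^const>\<open>deriv\<close>, closure under sums and products needs no congruence argument about
  functions that agree on \<open>S\<close> only.\<close>

primrec times_differentiable :: "nat \<Rightarrow> real set \<Rightarrow> (real \<Rightarrow> real) \<Rightarrow> bool" where
  "times_differentiable 0 S f \<longleftrightarrow> True"
| "times_differentiable (Suc k) S f \<longleftrightarrow>
     (\<exists>f'. (\<forall>x\<in>S. (f has_real_derivative f' x) (at x)) \<and> times_differentiable k S f')"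

lemma times_differentiable_Suc_imp:
  "times_differentiable (Suc k) S f \<Longrightarrow> times_differentiable k S f"
proof (induction k arbitrary: f)
  case (Suc k)
  then show ?case by (metis times_differentiable.simps(2))
qed simp

lemma times_differentiable_const: "times_differentiable k S (\<lambda>_. a)"
  by (induction k arbitrary: a) (auto intro!: exI[of _ "\<lambda>_. 0"])

lemma times_differentiable_ident: "times_differentiable k S (\<lambda>x. x)"
  by (cases k) (auto intro!: exI[of _ "\<lambda>_. 1"] times_differentiable_const)

lemma times_differentiable_add:
  "times_differentiable k S f \<Longrightarrow> times_differentiable k S g \<Longrightarrow>
   times_differentiable k S (\<lambda>x. f x + g x)"
proof (induction k arbitrary: f g)
  case (Suc k)
  then obtain f' g' where f: "\<forall>x\<in>S. (f has_real_derivative f' x) (at x)" "times_differentiable k S f'"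
    and g: "\<forall>x\<in>S. (g has_real_derivative g' x) (at x)" "times_differentiable k S g'" by auto
  show ?case
    using f g Suc.IH by (auto intro!: exI[of _ "\<lambda>x. f' x + g' x"] derivative_intros)
qed simp

lemma times_differentiable_mult:
  "times_differentiable k S f \<Longrightarrow> times_differentiable k S g \<Longrightarrow>
   times_differentiable k S (\<lambda>x. f x * g x)"
proof (induction k arbitrary: f g)
  case (Suc k)
  then obtain f' g' where f: "\<forall>x\<in>S. (f has_real_derivative f' x) (at x)" "times_differentiable k S f'"
    and g: "\<forall>x\<in>S. (g has_real_derivative g' x) (at x)" "times_differentiable k S g'" by auto
  have "times_differentiable k S f" "times_differentiable k S g"
    using Suc.prems times_differentiable_Suc_imp by blast+
  then have "times_differentiable k S (\<lambda>x. f' x * g x + g' x * f x)"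
    by (intro times_differentiable_add Suc.IH f(2) g(2))
  moreover have "\<forall>x\<in>S. ((\<lambda>x. f x * g x) has_real_derivative f' x * g x + g' x * f x) (at x)"
    using f g by (auto intro: DERIV_mult)
  ultimately show ?case by auto
qed simp

lemma smooth_on_open_imp_times_differentiable:
  assumes "smooth_on_open S f"
  shows "times_differentiable k S ((deriv ^^ j) f)"
proof (induction k arbitrary: j)
  case (Suc k)
  have "((deriv ^^ j) f has_real_derivative (deriv ^^ Suc j) f x) (at x)" if "x \<in> S" for x
  proof -
    have "(deriv ^^ j) f differentiable (at x)"
      using assms that unfolding smooth_on_open_def
      by (metis at_within_open differentiable_on_def)
    then show ?thesis by (simp add: DERIV_deriv_iff_real_differentiable)
  qed
  then show ?case using Suc.IH[of "Suc j"] by auto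
qed simp

text \<open>The successive derivatives of \<open>F 0\<close>, given as a family; this is the form in which the mean-value
  version of Taylor's theorem takes its derivatives.\<close>

definition derivative_tower :: "nat \<Rightarrow> real set \<Rightarrow> (nat \<Rightarrow> real \<Rightarrow> real) \<Rightarrow> bool" where
  "derivative_tower n I F \<longleftrightarrow>
     (\<forall>k<n. \<forall>t\<in>I. (F k has_real_derivative F (Suc k) t) (at t))"

text \<open>Along a solution of \<open>u' = G(u)\<close> one has \<open>(f \<circ> u)' = (f' G) \<circ> u\<close>, so each derivative of \<open>f \<circ> u\<close> is again
  a function of the state evaluated along \<open>u\<close>. Thus the regularity of \<open>u\<close> and of \<open>N \<circ> u\<close> follows from products
  on the state space alone, without bootstrapping or a higher-order chain rule.\<close>

lemma derivative_tower_along_flow: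
  assumes u: "\<And>t. t \<in> I \<Longrightarrow> u t \<in> S \<and> (u has_real_derivative G (u t)) (at t)"
    and "times_differentiable n S G" "times_differentiable n S f"
  shows "\<exists>F. F 0 = f \<circ> u \<and> derivative_tower n I F"
  using assms(2,3)
proof (induction n arbitrary: f)
  case 0
  then show ?case by (auto simp: derivative_tower_def intro: exI[of _ "\<lambda>_. f \<circ> u"])
next
  case (Suc n)
  then obtain f' where f: "\<forall>x\<in>S. (f has_real_derivative f' x) (at x)" "times_differentiable n S f'"
    by auto
  have G: "times_differentiable n S G"
    using Suc.prems(1) times_differentiable_Suc_imp by blast
  obtain F where F: "F 0 = (\<lambda>x. f' x * G x) \<circ> u" "derivative_tower n I F"
    using Suc.IH[OF G times_differentiable_mult[OF f(2) G]] by blast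
  define H where "H = case_nat (f \<circ> u) F"
  have "(H k has_real_derivative H (Suc k) t) (at t)" if "k < Suc n" "t \<in> I" for k t
  proof (cases k)
    case 0
    have "((\<lambda>t. f (u t)) has_real_derivative f' (u t) * G (u t)) (at t)"
      using u[OF that(2)] f(1) by (intro DERIV_chain2[of f]) auto
    then show ?thesis using 0 F(1) by (simp add: H_def o_def)
  next
    case (Suc j)
    then show ?thesis using that F(2) by (auto simp: H_def derivative_tower_def)
  qed
  then show ?case by (auto simp: derivative_tower_def H_def intro!: exI[of _ H])
qed

lemma derivative_tower_bounded:
  assumes "derivative_tower (Suc n) {\<alpha>..\<beta>} F"
  obtains B where "B \<ge> 0" "\<And>t. t \<in> {\<alpha>..\<beta>} \<Longrightarrow> \<bar>F n t\<bar> \<le> B"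
proof -
  have "isCont (F n) t" if "t \<in> {\<alpha>..\<beta>}" for t
    by (rule DERIV_isCont[of _ "F (Suc n) t"]) (use assms that in \<open>auto simp: derivative_tower_def\<close>)
  then have "continuous_on {\<alpha>..\<beta>} (F n)"
    by (intro continuous_at_imp_continuous_on) auto
  then show ?thesis
    using continuous_on_compact_bound[OF compact_Icc, of \<alpha> \<beta> "F n"] that by auto
qed

lemma derivative_tower_mono:
  "derivative_tower n I F \<Longrightarrow> m \<le> n \<Longrightarrow> J \<subseteq> I \<Longrightarrow> derivative_tower m J F"
  by (auto simp: derivative_tower_def)

section \<open>Taylor estimates\<close>

lemma taylor_remainder_bound:
  assumes F: "derivative_tower n {\<alpha>..\<beta>} F" and "n > 0"
    and B: "\<And>t. t \<in> {\<alpha>..\<beta>} \<Longrightarrow> \<bar>F n t\<bar> \<le> B"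
    and t: "t \<in> {\<alpha>..\<beta>}" and y: "t + y \<in> {\<alpha>..\<beta>}"
  shows "\<bar>F 0 (t + y) - (\<Sum>m<n. F m t / fact m * y ^ m)\<bar> \<le> B * \<bar>y\<bar> ^ n"
proof (cases "y = 0")
  case True
  have "(\<Sum>m<n. F m t / fact m * y ^ m) = (\<Sum>m<n. if m = 0 then F 0 t else 0)"
    using True by (intro sum.cong) auto
  then show ?thesis using True \<open>n > 0\<close> by (simp add: power_0_left)
next
  case False
  obtain z where z: "if t + y < t then t + y < z \<and> z < t else t < z \<and> z < t + y"
    and eq: "F 0 (t + y) = (\<Sum>m<n. F m t / fact m * (t + y - t) ^ m) + F n z / fact n * (t + y - t) ^ n"
    using Taylor[of n F "F 0" \<alpha> \<beta> t "t + y"] assms False by (auto simp: derivative_tower_def)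
  have zI: "z \<in> {\<alpha>..\<beta>}" using z t y by (auto split: if_splits)
  have "\<bar>F n z\<bar> / fact n \<le> B / 1"
    using B[OF zI] by (intro frac_le) (auto simp: fact_ge_1 intro: order_trans[OF abs_ge_zero])
  then have "\<bar>F n z / fact n * y ^ n\<bar> \<le> B * \<bar>y\<bar> ^ n"
    using mult_right_mono[of "\<bar>F n z\<bar> / fact n" B "\<bar>y\<bar> ^ n"] by (simp add: abs_mult power_abs)
  then show ?thesis using eq by simp
qed

text \<open>A weighted sum of point values differs from its action on the Taylor polynomial by the remainder, and
  on the Taylor polynomial it only depends on the moments of the weights. Both consistency
  estimates below are instances: one for the rows of \<open>D\<close>, one for the collocation weights.\<close>

lemma taylor_moment_bound:
  fixes w x :: "'i \<Rightarrow> real"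
  assumes F: "derivative_tower n {\<alpha>..\<beta>} F" and "n > 0"
    and B: "\<And>t. t \<in> {\<alpha>..\<beta>} \<Longrightarrow> \<bar>F n t\<bar> \<le> B"
    and t: "t \<in> {\<alpha>..\<beta>}" and h: "0 \<le> h"
    and x: "\<And>l. l \<in> L \<Longrightarrow> t + x l * h \<in> {\<alpha>..\<beta>}" "\<And>l. l \<in> L \<Longrightarrow> \<bar>x l\<bar> \<le> 1"
    and \<mu>: "\<And>m. m < n \<Longrightarrow> (\<Sum>l\<in>L. w l * x l ^ m) = \<mu> m"
  shows "\<bar>(\<Sum>l\<in>L. w l * F 0 (t + x l * h)) - (\<Sum>m<n. F m t / fact m * h ^ m * \<mu> m)\<bar>
           \<le> B * (\<Sum>l\<in>L. \<bar>w l\<bar>) * h ^ n"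
proof -
  have B0: "0 \<le> B" using B[OF t] by linarith
  have "(\<Sum>m<n. F m t / fact m * h ^ m * \<mu> m)
      = (\<Sum>m<n. \<Sum>l\<in>L. w l * (F m t / fact m * (x l * h) ^ m))"
  proof (rule sum.cong)
    fix m assume "m \<in> {..<n}"
    then have "F m t / fact m * h ^ m * \<mu> m = F m t / fact m * h ^ m * (\<Sum>l\<in>L. w l * x l ^ m)"
      by (simp add: \<mu>)
    also have "\<dots> = (\<Sum>l\<in>L. w l * (F m t / fact m * (x l * h) ^ m))"
      unfolding sum_distrib_left by (intro sum.cong) (auto simp: power_mult_distrib)
    finally show "F m t / fact m * h ^ m * \<mu> m = (\<Sum>l\<in>L. w l * (F m t / fact m * (x l * h) ^ m))" .
  qed simp
  also have "\<dots> = (\<Sum>l\<in>L. w l * (\<Sum>m<n. F m t / fact m * (x l * h) ^ m))"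
    by (subst sum.swap) (simp add: sum_distrib_left)
  finally have "\<bar>(\<Sum>l\<in>L. w l * F 0 (t + x l * h)) - (\<Sum>m<n. F m t / fact m * h ^ m * \<mu> m)\<bar>
    = \<bar>\<Sum>l\<in>L. w l * (F 0 (t + x l * h) - (\<Sum>m<n. F m t / fact m * (x l * h) ^ m))\<bar>"
    by (simp add: sum_subtractf right_diff_distrib)
  also have "\<dots> \<le> (\<Sum>l\<in>L. \<bar>w l\<bar> * (B * h ^ n))"
  proof (rule order_trans[OF sum_abs], rule sum_mono)
    fix l assume l: "l \<in> L"
    have "\<bar>F 0 (t + x l * h) - (\<Sum>m<n. F m t / fact m * (x l * h) ^ m)\<bar> \<le> B * \<bar>x l * h\<bar> ^ n"
      by (rule taylor_remainder_bound[OF F \<open>n > 0\<close> B t x(1)[OF l]])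
    also have "\<dots> \<le> B * h ^ n"
      using x(2)[OF l] h B0 by (intro mult_left_mono power_mono) (auto simp: abs_mult mult_left_le_one_le)
    finally show "\<bar>w l * (F 0 (t + x l * h) - (\<Sum>m<n. F m t / fact m * (x l * h) ^ m))\<bar>
        \<le> \<bar>w l\<bar> * (B * h ^ n)"
      by (simp add: abs_mult mult_left_mono)
  qed
  also have "\<dots> = B * (\<Sum>l\<in>L. \<bar>w l\<bar>) * h ^ n" by (simp add: sum_distrib_left mult_ac)
  finally show ?thesis .
qed

section \<open>Consistency of the step and of collocation\<close>

lemma lagrange_basis_at_node:
  assumes "inj_on (\<lambda>k. c $ k) {..<s}" "i < s" "j < s"
  shows "lagrange_basis s c j (c $ i) = (if i = j then 1 else 0)"
proof (cases "i = j")
  case True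
  have "(c $ i - c $ k) / (c $ j - c $ k) = 1" if "k \<in> {..<s} - {j}" for k
    using that assms True by (auto simp: inj_on_def)
  then show ?thesis using True by (simp add: lagrange_basis_def)
next
  case False
  then show ?thesis using assms by (auto simp: lagrange_basis_def intro!: prod_zero bexI[of _ i])
qed

lemma lagrange_basis_integrable: "lagrange_basis s c j integrable_on {x..y}"
  unfolding lagrange_basis_def divide_inverse
  by (intro integrable_continuous_real continuous_intros)

text \<open>Both sides are polynomials in \<open>\<tau>\<close> of degree less than \<open>s\<close> that agree at the \<open>s\<close> nodes.\<close>

lemma lagrange_reproduces_monomials:
  assumes inj: "inj_on (\<lambda>k. c $ k) {..<s}" and m: "m < s"
  shows "(\<Sum>j<s. lagrange_basis s c j \<tau> * (c $ j) ^ m) = \<tau> ^ m"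
proof -
  define l where "l j = (\<Prod>k\<in>{..<s} - {j}. [:- c $ k / (c $ j - c $ k), 1 / (c $ j - c $ k):])" for j
  define P where "P = (\<Sum>j<s. Polynomial.smult ((c $ j) ^ m) (l j))"
  have l: "poly (l j) x = lagrange_basis s c j x" for j x
    unfolding l_def lagrange_basis_def poly_prod
    by (intro prod.cong) (auto simp: diff_divide_distrib)
  have P: "poly P x = (\<Sum>j<s. lagrange_basis s c j x * (c $ j) ^ m)" for x
    by (simp add: P_def poly_sum l mult.commute)
  have deg_l: "degree (l j) \<le> s - 1" if "j < s" for j
  proof -
    have "degree (l j) \<le> (\<Sum>k\<in>{..<s} - {j}. 1)"
      unfolding l_def
      by (rule order_trans[OF degree_prod_sum_le], simp, rule sum_mono) (auto simp: degree_pCons_le)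
    then show ?thesis using that by simp
  qed
  have "degree P \<le> s - 1"
    unfolding P_def using deg_l by (intro degree_sum_le) (auto intro: order_trans[OF degree_smult_le])
  moreover have "card ((\<lambda>k. c $ k) ` {..<s}) = s" using inj by (simp add: card_image)
  moreover have "poly P x = poly (Polynomial.monom 1 m) x" if "x \<in> (\<lambda>k. c $ k) ` {..<s}" for x
  proof -
    obtain i where i: "i < s" "x = c $ i" using \<open>x \<in> _\<close> by auto
    have "poly P x = (\<Sum>j<s. if j = i then (c $ j) ^ m else 0)"
      unfolding P i(2) using i(1) by (intro sum.cong) (auto simp: lagrange_basis_at_node[OF inj])
    then show ?thesis using i by (simp add: poly_monom)
  qed
  ultimately have "P = Polynomial.monom 1 m"
    using m by (intro poly_eqI_degree[of "(\<lambda>k. c $ k) ` {..<s}"]) (auto simp: degree_monom_eq)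
  then show ?thesis by (metis P poly_monom mult_1)
qed

text \<open>The collocation weights integrate polynomials of degree less than \<open>s\<close> exactly; this is
  where the special form of the Runge--Kutta coefficients enters.\<close>

lemma interpolatory_quadrature_moments:
  assumes inj: "inj_on (\<lambda>k. c $ k) {..<s}" and m: "m < s" and x: "0 \<le> x"
  shows "(\<Sum>j<s. integral {0..x} (lagrange_basis s c j) * (c $ j) ^ m) = x ^ Suc m / real (Suc m)"
proof -
  have "((\<lambda>\<tau>. \<Sum>j<s. lagrange_basis s c j \<tau> * (c $ j) ^ m) has_integral
      (\<Sum>j<s. integral {0..x} (lagrange_basis s c j) * (c $ j) ^ m)) {0..x}"
    by (intro has_integral_sum has_integral_mult_left integrable_integral lagrange_basis_integrable) auto
  then have "((\<lambda>\<tau>. \<tau> ^ m) has_integral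
      (\<Sum>j<s. integral {0..x} (lagrange_basis s c j) * (c $ j) ^ m)) {0..x}"
    by (simp add: lagrange_reproduces_monomials[OF inj m])
  moreover have "((\<lambda>\<tau>. \<tau> ^ m) has_integral x ^ Suc m / real (Suc m) - 0 ^ Suc m / real (Suc m)) {0..x}"
  proof (rule fundamental_theorem_of_calculus[OF x])
    fix y :: real
    have "((\<lambda>\<tau>. \<tau> ^ Suc m / real (Suc m)) has_real_derivative
        (real (Suc m) * y ^ m) / real (Suc m)) (at y within {0..x})"
      by (intro DERIV_cdivide) (use DERIV_power[OF DERIV_ident, of "Suc m" y] in simp)
    then show "((\<lambda>\<tau>. \<tau> ^ Suc m / real (Suc m)) has_vector_derivative y ^ m) (at y within {0..x})"
      unfolding has_real_derivative_iff_has_vector_derivative by (simp del: of_nat_Suc)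
  qed
  ultimately have "(\<Sum>j<s. integral {0..x} (lagrange_basis s c j) * (c $ j) ^ m)
      = x ^ Suc m / real (Suc m) - 0 ^ Suc m / real (Suc m)"
    by (rule has_integral_unique)
  then show ?thesis by simp
qed

text \<open>The order condition for the single value \<open>h = 1\<close>, entry by entry: the power \<open>h\<^sup>m\<close> cancels from column
  \<open>m\<close> of the condition for general \<open>h\<close>.\<close>

lemma step_of_order_moments:
  assumes "step_of_order s c D \<theta>" "D \<in> carrier_mat s s" "i < s" "m < s"
  shows "(\<Sum>j<s. D $$ (i, j) * (c $ j - 1) ^ m) = (c $ i) ^ m - (if m = 0 then \<theta> $ i else 0)"
proof -
  have eq: "Matrix.mat s s (\<lambda>(i, j). (c $ i) ^ j) =
        D * Matrix.mat s s (\<lambda>(i, j). (c $ i - 1) ^ j)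
        + Matrix.mat s s (\<lambda>(i, j). if j = 0 then \<theta> $ i else 0)"
    using assms(1)[unfolded step_of_order_def, rule_format, of 1] by simp
  have "(c $ i) ^ m = (\<Sum>j<s. D $$ (i, j) * (c $ j - 1) ^ m) + (if m = 0 then \<theta> $ i else 0)"
    using arg_cong[OF eq, of "\<lambda>X. X $$ (i, m)"] assms(2-4)
    by (simp add: scalar_prod_def atLeast0LessThan)
  then show ?thesis by simp
qed

text \<open>By the order condition the step reproduces the Taylor polynomial of degree less than \<open>s\<close> about \<open>t\<close>:
  its contribution at \<open>t + c\<^sub>i h\<close> is recovered from the nodes \<open>t + (c\<^sub>j - 1) h\<close> and the correction
  \<open>\<theta>\<^sub>i\<close> of the constant term. Only the remainder of order \<open>h\<^sup>s\<close> is left.\<close>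

lemma step_consistency:
  assumes ord: "step_of_order s c D \<theta>" and D: "D \<in> carrier_mat s s" and "s > 0"
    and c: "\<And>i. i < s \<Longrightarrow> 0 \<le> c $ i \<and> c $ i \<le> 1"
    and F: "derivative_tower s {\<alpha>..\<beta>} F" and B: "\<And>t. t \<in> {\<alpha>..\<beta>} \<Longrightarrow> \<bar>F s t\<bar> \<le> B"
  shows "\<exists>K\<ge>0. \<forall>t h. 0 < h \<and> \<alpha> \<le> t - h \<and> t + h \<le> \<beta> \<longrightarrow> (\<forall>i<s.
     \<bar>F 0 (t + c $ i * h) - ((\<Sum>j<s. D $$ (i, j) * F 0 (t - h + c $ j * h)) + F 0 t * \<theta> $ i)\<bar>
       \<le> K * h ^ s)"
proof (cases "\<alpha> \<le> \<beta>")
  case False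
  then show ?thesis by (intro exI[of _ 0]) auto
next
  case True
  then have B0: "0 \<le> B" using B[of \<alpha>] by auto
  define K where "K = B + B * (\<Sum>i<s. \<Sum>j<s. \<bar>D $$ (i, j)\<bar>)"
  have "K \<ge> 0" using B0 by (auto simp: K_def intro!: add_nonneg_nonneg mult_nonneg_nonneg sum_nonneg)
  moreover have "\<bar>F 0 (t + c $ i * h) - ((\<Sum>j<s. D $$ (i, j) * F 0 (t - h + c $ j * h)) + F 0 t * \<theta> $ i)\<bar>
       \<le> K * h ^ s" if h: "0 < h" "\<alpha> \<le> t - h" "t + h \<le> \<beta>" and i: "i < s" for t h i
  proof -
    have tI: "t \<in> {\<alpha>..\<beta>}" using h by auto
    have ch: "0 \<le> c $ j * h" "c $ j * h \<le> h" if "j < s" for j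
      using c[OF that] h(1) by (auto simp: mult_left_le_one_le)
    define T where "T = (\<Sum>m<s. F m t / fact m * (c $ i * h) ^ m)"
    define S where "S = (\<Sum>m<s. F m t / fact m * h ^ m * ((c $ i) ^ m - (if m = 0 then \<theta> $ i else 0)))"
    have "\<bar>(\<Sum>j\<in>{..<s}. D $$ (i, j) * F 0 (t + (c $ j - 1) * h)) - S\<bar>
        \<le> B * (\<Sum>j\<in>{..<s}. \<bar>D $$ (i, j)\<bar>) * h ^ s"
      unfolding S_def
    proof (rule taylor_moment_bound[OF F \<open>s > 0\<close> B tI])
      show "t + (c $ j - 1) * h \<in> {\<alpha>..\<beta>}" if "j \<in> {..<s}" for j
        using ch[OF that[THEN lessThan_iff[THEN iffD1]]] h(2,3)
        unfolding atLeastAtMost_iff left_diff_distrib by linarith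
      show "\<bar>c $ j - 1\<bar> \<le> 1" if "j \<in> {..<s}" for j
        using c[of j] that by auto
    qed (use h step_of_order_moments[OF ord D i] in auto)
    moreover have "B * (\<Sum>j<s. \<bar>D $$ (i, j)\<bar>) * h ^ s \<le> B * (\<Sum>i<s. \<Sum>j<s. \<bar>D $$ (i, j)\<bar>) * h ^ s"
      using B0 h i by (intro mult_right_mono mult_left_mono member_le_sum[of i "{..<s}" "\<lambda>i. \<Sum>j<s. \<bar>D $$ (i, j)\<bar>"])
        (auto intro: sum_nonneg)
    moreover have "\<bar>F 0 (t + c $ i * h) - T\<bar> \<le> B * h ^ s"
    proof -
      have "\<bar>F 0 (t + c $ i * h) - T\<bar> \<le> B * \<bar>c $ i * h\<bar> ^ s"
        unfolding T_def using ch[OF i] h(2,3)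
        by (intro taylor_remainder_bound[OF F \<open>s > 0\<close> B tI]) (simp, unfold atLeastAtMost_iff, linarith)
      also have "\<dots> \<le> B * h ^ s"
        using ch[OF i] B0 by (intro mult_left_mono power_mono) (unfold abs_le_iff, linarith+)
      finally show ?thesis .
    qed
    moreover have "S = T - F 0 t * \<theta> $ i"
    proof -
      have "S = (\<Sum>m<s. F m t / fact m * (c $ i * h) ^ m - (if m = 0 then F 0 t * \<theta> $ i else 0))"
        unfolding S_def by (intro sum.cong) (auto simp: power_mult_distrib algebra_simps)
      then show ?thesis using \<open>s > 0\<close> by (simp add: sum_subtractf T_def)
    qed
    moreover have "(\<Sum>j<s. D $$ (i, j) * F 0 (t - h + c $ j * h))
        = (\<Sum>j<s. D $$ (i, j) * F 0 (t + (c $ j - 1) * h))"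
    proof -
      have "t - h + c $ j * h = t + (c $ j - 1) * h" for j by (simp add: left_diff_distrib)
      then show ?thesis by presburger
    qed
    moreover have "K * h ^ s = B * h ^ s + B * (\<Sum>i<s. \<Sum>j<s. \<bar>D $$ (i, j)\<bar>) * h ^ s"
      unfolding K_def by (rule distrib_right)
    ultimately show ?thesis by linarith
  qed
  ultimately show ?thesis by blast
qed

text \<open>The quadrature integrates the Taylor polynomial of the derivative \<open>F 1\<close> exactly, which leaves
  \<open>h\<close> times a remainder of order \<open>h\<^sup>s\<close>. The constant is uniform in the endpoint \<open>x\<close> of the quadrature, so
  that \<open>x = c\<^sub>i\<close> (stages) and \<open>x = 1\<close> (final update) are covered together.\<close>

lemma collocation_consistency:
  assumes inj: "inj_on (\<lambda>k. c $ k) {..<s}" and "s > 0"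
    and c: "\<And>j. j < s \<Longrightarrow> 0 \<le> c $ j \<and> c $ j \<le> 1"
    and F: "derivative_tower (Suc s) {\<alpha>..\<beta>} F"
    and B: "\<And>t. t \<in> {\<alpha>..\<beta>} \<Longrightarrow> \<bar>F (Suc s) t\<bar> \<le> B"
  shows "\<exists>K\<ge>0. \<forall>x\<in>{0..1}. \<forall>t h. 0 < h \<and> \<alpha> \<le> t \<and> t + h \<le> \<beta> \<longrightarrow>
     \<bar>F 0 (t + x * h) - (F 0 t + h * (\<Sum>j<s. integral {0..x} (lagrange_basis s c j) * F 1 (t + c $ j * h)))\<bar>
       \<le> K * h ^ Suc s"
proof (cases "\<alpha> \<le> \<beta>")
  case False
  then show ?thesis by (intro exI[of _ 0]) auto
next
  case True
  then have B0: "0 \<le> B" using B[of \<alpha>] by auto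
  define W where "W j = integral {0..1} (\<lambda>\<tau>. \<bar>lagrange_basis s c j \<tau>\<bar>)" for j
  define K where "K = B + B * (\<Sum>j<s. W j)"
  have int: "(\<lambda>\<tau>. \<bar>lagrange_basis s c j \<tau>\<bar>) integrable_on {0..y}" for j y
    unfolding lagrange_basis_def divide_inverse
    by (intro integrable_continuous_real continuous_intros)
  have "W j \<ge> 0" for j unfolding W_def by (intro integral_nonneg int) auto
  then have "K \<ge> 0" using B0 by (auto simp: K_def intro!: add_nonneg_nonneg mult_nonneg_nonneg sum_nonneg)
  moreover have "\<bar>F 0 (t + x * h) - (F 0 t + h * (\<Sum>j<s. integral {0..x} (lagrange_basis s c j) * F 1 (t + c $ j * h)))\<bar>
      \<le> K * h ^ Suc s"
    if "x \<in> {0..1}" and h: "0 < h" "\<alpha> \<le> t" "t + h \<le> \<beta>" for x t h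
  proof -
    have x: "0 \<le> x" "x \<le> 1" using \<open>x \<in> {0..1}\<close> by auto
    define w where "w j = integral {0..x} (lagrange_basis s c j)" for j
    have w_le: "\<bar>w j\<bar> \<le> W j" for j
    proof -
      have "\<bar>w j\<bar> \<le> integral {0..x} (\<lambda>\<tau>. \<bar>lagrange_basis s c j \<tau>\<bar>)"
        unfolding w_def real_norm_def[symmetric]
        by (rule Henstock_Kurzweil_Integration.integral_norm_bound_integral[OF lagrange_basis_integrable])
          (use int in auto)
      also have "\<dots> \<le> W j" unfolding W_def using x by (intro integral_subset_le int) auto
      finally show ?thesis .
    qed
    have tI: "t \<in> {\<alpha>..\<beta>}" using h by auto
    have xh: "0 \<le> x * h" "x * h \<le> h" using x h by (auto simp: mult_left_le_one_le)
    have ch: "0 \<le> c $ j * h" "c $ j * h \<le> h" if "j < s" for j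
      using c[OF that] h(1) by (auto simp: mult_left_le_one_le)
    define G where "G k = F (Suc k)" for k
    have G: "derivative_tower s {\<alpha>..\<beta>} G" using F by (auto simp: derivative_tower_def G_def)
    define T where "T = (\<Sum>m<Suc s. F m t / fact m * (x * h) ^ m)"
    define S where "S = (\<Sum>m<s. G m t / fact m * h ^ m * (x ^ Suc m / real (Suc m)))"
    have "\<bar>(\<Sum>j\<in>{..<s}. w j * G 0 (t + c $ j * h)) - S\<bar> \<le> B * (\<Sum>j\<in>{..<s}. \<bar>w j\<bar>) * h ^ s"
      unfolding S_def
    proof (rule taylor_moment_bound[OF G \<open>s > 0\<close> _ tI])
      show "\<bar>G s t\<bar> \<le> B" if "t \<in> {\<alpha>..\<beta>}" for t using B[OF that] by (simp add: G_def)
      show "t + c $ j * h \<in> {\<alpha>..\<beta>}" if "j \<in> {..<s}" for j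
        using ch[OF that[THEN lessThan_iff[THEN iffD1]]] h(2,3)
        unfolding atLeastAtMost_iff by linarith
      show "\<bar>c $ j\<bar> \<le> 1" if "j \<in> {..<s}" for j
        using c[of j] that by auto
    qed (use h interpolatory_quadrature_moments[OF inj _ x(1)] in \<open>auto simp: w_def\<close>)
    then have "h * \<bar>(\<Sum>j<s. w j * F 1 (t + c $ j * h)) - S\<bar> \<le> h * (B * (\<Sum>j<s. \<bar>w j\<bar>) * h ^ s)"
      using h by (intro mult_left_mono) (auto simp: G_def)
    then have "\<bar>h * (\<Sum>j<s. w j * F 1 (t + c $ j * h)) - h * S\<bar> \<le> B * (\<Sum>j<s. \<bar>w j\<bar>) * h ^ Suc s"
    proof -
      have "\<bar>h * p - h * S\<bar> = h * \<bar>p - S\<bar>" for p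
        using h by (simp add: abs_mult flip: right_diff_distrib)
      moreover have "h * (B * (\<Sum>j<s. \<bar>w j\<bar>) * h ^ s) = B * (\<Sum>j<s. \<bar>w j\<bar>) * h ^ Suc s" by simp
      ultimately show ?thesis using \<open>h * _ \<le> _\<close> by presburger
    qed
    moreover have "\<bar>F 0 (t + x * h) - T\<bar> \<le> B * h ^ Suc s"
    proof -
      have "\<bar>F 0 (t + x * h) - T\<bar> \<le> B * \<bar>x * h\<bar> ^ Suc s"
        unfolding T_def using xh h(2,3)
        by (intro taylor_remainder_bound[OF F _ B tI]) (simp, simp, unfold atLeastAtMost_iff, linarith)
      also have "\<dots> \<le> B * h ^ Suc s"
        using xh B0 by (intro mult_left_mono power_mono) (unfold abs_le_iff, linarith+)
      finally show ?thesis .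
    qed
    moreover have "h * S = T - F 0 t"
    proof -
      have "T = F 0 t + (\<Sum>m<s. F (Suc m) t / fact (Suc m) * (x * h) ^ Suc m)"
        unfolding T_def by (subst sum.lessThan_Suc_shift) simp
      also have "(\<Sum>m<s. F (Suc m) t / fact (Suc m) * (x * h) ^ Suc m) = h * S"
        unfolding S_def sum_distrib_left
        by (intro sum.cong) (simp_all add: G_def power_mult_distrib mult_ac del: of_nat_Suc)
      finally show ?thesis by simp
    qed
    moreover have "B * (\<Sum>j<s. \<bar>w j\<bar>) * h ^ Suc s \<le> B * (\<Sum>j<s. W j) * h ^ Suc s"
      using B0 h w_le by (intro mult_right_mono mult_left_mono sum_mono) auto
    moreover have "K * h ^ Suc s = B * h ^ Suc s + B * (\<Sum>j<s. W j) * h ^ Suc s"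
      unfolding K_def by (rule distrib_right)
    ultimately show ?thesis unfolding w_def by linarith
  qed
  ultimately show ?thesis by blast
qed

section \<open>A norm adapted to a strongly stable step\<close>

lemma smult_pow_mat:
  fixes A :: "'a :: comm_ring_1 mat"
  assumes A: "A \<in> carrier_mat n n"
  shows "(a \<cdot>\<^sub>m A) ^\<^sub>m k = a ^ k \<cdot>\<^sub>m (A ^\<^sub>m k)"
proof (induction k)
  case (Suc k)
  have "(a \<cdot>\<^sub>m A) ^\<^sub>m Suc k = (a ^ k \<cdot>\<^sub>m (A ^\<^sub>m k)) * (a \<cdot>\<^sub>m A)" using Suc by simp
  also have "\<dots> = a \<cdot>\<^sub>m ((a ^ k \<cdot>\<^sub>m (A ^\<^sub>m k)) * A)"
    by (rule mult_smult_distrib[of _ n n _ n]) (use A in auto)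
  also have "(a ^ k \<cdot>\<^sub>m (A ^\<^sub>m k)) * A = a ^ k \<cdot>\<^sub>m (A ^\<^sub>m k * A)"
    by (rule mult_smult_assoc_mat[of _ n n _ n]) (use A in auto)
  finally show ?case by (auto simp: mult_ac)
qed (use A in auto)

lemma eigenvalue_smult_mat:
  fixes A :: "'a :: field mat"
  assumes A: "A \<in> carrier_mat n n" and "q \<noteq> 0" and "eigenvalue (inverse q \<cdot>\<^sub>m A) a"
  shows "eigenvalue A (q * a)"
proof -
  from assms obtain v where v: "v \<in> carrier_vec n" "v \<noteq> 0\<^sub>v n"
    and eq: "(inverse q \<cdot>\<^sub>m A) *\<^sub>v v = a \<cdot>\<^sub>v v"
    unfolding eigenvalue_def eigenvector_def by auto
  have "A *\<^sub>v v = (q * a) \<cdot>\<^sub>v v"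
  proof (rule eq_vecI)
    fix i assume i: "i < dim_vec ((q * a) \<cdot>\<^sub>v v)"
    then have "inverse q * (A *\<^sub>v v) $ i = a * v $ i"
      using arg_cong[OF eq, of "\<lambda>v. v $ i"] v A by (simp add: scalar_prod_def sum_distrib_left mult_ac)
    then show "(A *\<^sub>v v) $ i = ((q * a) \<cdot>\<^sub>v v) $ i"
      using \<open>q \<noteq> 0\<close> i by (simp add: field_simps)
  qed (use A v in auto)
  then show ?thesis using v A unfolding eigenvalue_def eigenvector_def by auto
qed

text \<open>Choose \<open>q\<close> strictly between the spectral radius and \<open>1\<close>. Then \<open>D / q\<close> still has spectral radius less than
  \<open>1\<close>, and boundedness of its powers is geometric decay of the powers of \<open>D\<close>.\<close>

lemma strongly_stable_powers_decay:
  assumes D: "D \<in> carrier_mat s s" and "s > 0" and stab: "strongly_stable_step D"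
  shows "\<exists>q K. 0 < q \<and> q < 1 \<and> K \<ge> 0 \<and>
    (\<forall>k i j. i < s \<longrightarrow> j < s \<longrightarrow> \<bar>(D ^\<^sub>m k) $$ (i, j)\<bar> \<le> K * q ^ k)"
proof -
  define E where "E = map_mat complex_of_real D"
  have E: "E \<in> carrier_mat s s" using D by (simp add: E_def)
  define \<rho> where "\<rho> = spectral_radius E"
  have \<rho>: "0 \<le> \<rho>" "\<rho> < 1"
    using spectral_radius_mem_max(1)[OF E \<open>s > 0\<close>] stab by (auto simp: \<rho>_def strongly_stable_step_def E_def)
  define q where "q = (1 + \<rho>) / 2"
  have q: "0 < q" "q < 1" "\<rho> < q" using \<rho> by (auto simp: q_def)
  define A where "A = inverse (complex_of_real q) \<cdot>\<^sub>m E"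
  have A: "A \<in> carrier_mat s s" using E by (simp add: A_def)
  have "spectral_radius A < 1"
  proof -
    obtain a where a: "a \<in> spectrum A" "spectral_radius A = norm a"
      using spectral_radius_mem_max(1)[OF A \<open>s > 0\<close>] by auto
    then have "complex_of_real q * a \<in> spectrum E"
      using eigenvalue_smult_mat[OF E, of "complex_of_real q" a] q unfolding spectrum_def A_def by auto
    then have "norm (complex_of_real q * a) \<le> \<rho>"
      using spectral_radius_mem_max(2)[OF E \<open>s > 0\<close>] by (auto simp: \<rho>_def)
    then have "q * norm a \<le> \<rho>" using q by (simp add: norm_mult)
    then have "q * norm a < q * 1" using q(3) by linarith
    then show ?thesis using a q by (simp only: mult_less_cancel_left_pos)
  qed
  then obtain K where K: "\<And>k. norm_bound (A ^\<^sub>m k) K"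
    using spectral_radius_jnf_norm_bound_less_1_upper_triangular[OF A] by blast
  have bound: "\<bar>(D ^\<^sub>m k) $$ (i, j)\<bar> \<le> K * q ^ k" if "i < s" "j < s" for k i j
  proof -
    have "(A ^\<^sub>m k) $$ (i, j) = inverse (complex_of_real q) ^ k * (E ^\<^sub>m k) $$ (i, j)"
      using that carrier_matD[OF pow_carrier_mat[OF E, of k]] by (simp add: A_def smult_pow_mat[OF E])
    also have "E ^\<^sub>m k = map_mat complex_of_real (D ^\<^sub>m k)"
      unfolding E_def by (rule of_real_hom.mat_hom_pow[OF D, symmetric])
    also have "map_mat complex_of_real (D ^\<^sub>m k) $$ (i, j) = complex_of_real ((D ^\<^sub>m k) $$ (i, j))"
      using that carrier_matD[OF pow_carrier_mat[OF D, of k]] by simp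
    finally have "norm ((A ^\<^sub>m k) $$ (i, j)) = \<bar>(D ^\<^sub>m k) $$ (i, j)\<bar> / q ^ k"
      using q by (simp add: norm_mult norm_power norm_inverse divide_inverse power_inverse)
    moreover have "norm ((A ^\<^sub>m k) $$ (i, j)) \<le> K"
      using K[of k] that carrier_matD[OF pow_carrier_mat[OF A, of k]] unfolding norm_bound_def by auto
    ultimately show ?thesis using q by (simp add: pos_divide_le_eq)
  qed
  moreover have "K \<ge> 0" using bound[of 0 0 0] \<open>s > 0\<close> by (auto intro: order_trans[OF abs_ge_zero])
  ultimately show ?thesis using q by blast
qed

text \<open>A subadditive functional, equivalent to the maximum norm, for which \<open>D\<close> contracts by the factor \<open>q\<close>.
  Equivalence is stated through componentwise bounds, which is how errors are given and used.\<close>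

definition adapted_norm :: "nat \<Rightarrow> real mat \<Rightarrow> real \<Rightarrow> real \<Rightarrow> (real vec \<Rightarrow> real) \<Rightarrow> bool" where
  "adapted_norm s D q \<kappa> p \<longleftrightarrow> (\<forall>v\<in>carrier_vec s.
     (\<forall>i<s. \<bar>v $ i\<bar> \<le> p v) \<and> (\<forall>B. (\<forall>i<s. \<bar>v $ i\<bar> \<le> B) \<longrightarrow> p v \<le> \<kappa> * B) \<and>
     p (D *\<^sub>v v) \<le> q * p v \<and> (\<forall>w\<in>carrier_vec s. p (v + w) \<le> p v + p w))"

text \<open>Take \<open>p v = sup\<^sub>k \<bar>D\<^sup>k v\<bar>\<^sub>1 / q\<^sup>k\<close>, finite by the decay of the powers. Applying \<open>D\<close> shifts the index \<open>k\<close>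
  by one, which costs exactly one factor \<open>q\<close>. In the maximum norm itself \<open>D\<close> need not be a contraction.\<close>

lemma adapted_norm_exists:
  assumes D: "D \<in> carrier_mat s s" and "s > 0" and stab: "strongly_stable_step D"
  shows "\<exists>q \<kappa> p. 0 < q \<and> q < 1 \<and> \<kappa> \<ge> 1 \<and> adapted_norm s D q \<kappa> p"
proof -
  obtain q K where q: "0 < q" "q < 1" and K: "K \<ge> 0"
    and pow: "\<And>k i j. i < s \<Longrightarrow> j < s \<Longrightarrow> \<bar>(D ^\<^sub>m k) $$ (i, j)\<bar> \<le> K * q ^ k"
    using strongly_stable_powers_decay[OF assms] by blast
  define S where "S v k = (\<Sum>i<s. \<bar>(D ^\<^sub>m k *\<^sub>v v) $ i\<bar>) / q ^ k" for v k
  define p where "p v = (SUP k. S v k)" for v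
  have Dk: "D ^\<^sub>m k \<in> carrier_mat s s" for k using D by simp
  have S_le: "S v k \<le> real s * (real s * (K * B))"
    if v: "v \<in> carrier_vec s" and B: "\<And>i. i < s \<Longrightarrow> \<bar>v $ i\<bar> \<le> B" for v k B
  proof -
    have "B \<ge> 0" using B[OF \<open>s > 0\<close>] by linarith
    have "\<bar>(D ^\<^sub>m k *\<^sub>v v) $ i\<bar> \<le> real s * (K * q ^ k * B)" if i: "i < s" for i
    proof -
      have "(D ^\<^sub>m k *\<^sub>v v) $ i = (\<Sum>j<s. (D ^\<^sub>m k) $$ (i, j) * v $ j)"
        using i carrier_vecD[OF v] carrier_matD[OF Dk[of k]]
        by (simp add: scalar_prod_def atLeast0LessThan)
      also have "\<bar>\<dots>\<bar> \<le> (\<Sum>j<s. K * q ^ k * B)"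
      proof (rule order_trans[OF sum_abs], rule sum_mono)
        fix j assume "j \<in> {..<s}"
        then show "\<bar>(D ^\<^sub>m k) $$ (i, j) * v $ j\<bar> \<le> K * q ^ k * B"
          unfolding abs_mult using pow[OF i] B K q by (intro mult_mono) auto
      qed
      finally show ?thesis by simp
    qed
    then have "(\<Sum>i<s. \<bar>(D ^\<^sub>m k *\<^sub>v v) $ i\<bar>) \<le> (\<Sum>i<s. real s * (K * q ^ k * B))"
      by (intro sum_mono) auto
    then show ?thesis using q by (simp add: S_def pos_divide_le_eq mult_ac)
  qed
  have bdd: "bdd_above (range (S v))" if v: "v \<in> carrier_vec s" for v
  proof -
    have "\<bar>v $ i\<bar> \<le> (\<Sum>j<s. \<bar>v $ j\<bar>)" if "i < s" for i
      using that by (intro member_le_sum[of i "{..<s}" "\<lambda>j. \<bar>v $ j\<bar>"]) auto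
    then show ?thesis using S_le[OF v] by (intro bdd_aboveI2) blast
  qed
  have S_le_p: "S v k \<le> p v" if "v \<in> carrier_vec s" for v k
    unfolding p_def by (rule cSUP_upper[OF _ bdd[OF that]]) simp
  have "adapted_norm s D q (max 1 (real s * (real s * K))) p"
    unfolding adapted_norm_def
  proof (intro ballI conjI allI impI)
    fix v :: "real vec" assume v: "v \<in> carrier_vec s"
    show "\<bar>v $ i\<bar> \<le> p v" if "i < s" for i
    proof -
      have "\<bar>v $ i\<bar> \<le> (\<Sum>j<s. \<bar>v $ j\<bar>)"
        using that by (intro member_le_sum[of i "{..<s}" "\<lambda>j. \<bar>v $ j\<bar>"]) auto
      also have "\<dots> = S v 0" using v D by (simp add: S_def)
      finally show ?thesis using S_le_p[OF v, of 0] by linarith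
    qed
    show "p v \<le> max 1 (real s * (real s * K)) * B" if B': "\<forall>i<s. \<bar>v $ i\<bar> \<le> B" for B
    proof -
      have B: "\<bar>v $ i\<bar> \<le> B" if "i < s" for i using B' that by blast
      have "p v \<le> real s * (real s * K) * B"
        unfolding p_def using S_le[OF v B] by (intro cSUP_least) (auto simp: mult_ac)
      also have "\<dots> \<le> max 1 (real s * (real s * K)) * B"
        using B[OF \<open>s > 0\<close>] by (intro mult_right_mono) auto
      finally show ?thesis .
    qed
    show "p (D *\<^sub>v v) \<le> q * p v"
      unfolding p_def[of "D *\<^sub>v v"]
    proof (rule cSUP_least)
      fix k
      have "D ^\<^sub>m k *\<^sub>v (D *\<^sub>v v) = D ^\<^sub>m Suc k *\<^sub>v v"
        using Dk[of k] D v by (simp add: assoc_mult_mat_vec[of _ s s _ s])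
      then have "S (D *\<^sub>v v) k = q * S v (Suc k)"
        using q by (simp add: S_def)
      then show "S (D *\<^sub>v v) k \<le> q * p v" using S_le_p[OF v] q by simp
    qed simp
    show "p (v + w) \<le> p v + p w" if w: "w \<in> carrier_vec s" for w
      unfolding p_def[of "v + w"]
    proof (rule cSUP_least)
      fix k
      have "S (v + w) k \<le> S v k + S w k"
      proof -
        have "(\<Sum>i<s. \<bar>(D ^\<^sub>m k *\<^sub>v (v + w)) $ i\<bar>)
            \<le> (\<Sum>i<s. \<bar>(D ^\<^sub>m k *\<^sub>v v) $ i\<bar> + \<bar>(D ^\<^sub>m k *\<^sub>v w) $ i\<bar>)"
        proof (rule sum_mono)
          fix i assume "i \<in> {..<s}"
          moreover have "D ^\<^sub>m k *\<^sub>v (v + w) = D ^\<^sub>m k *\<^sub>v v + D ^\<^sub>m k *\<^sub>v w"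
            by (rule mult_add_distrib_mat_vec[OF Dk v w])
          ultimately show "\<bar>(D ^\<^sub>m k *\<^sub>v (v + w)) $ i\<bar>
              \<le> \<bar>(D ^\<^sub>m k *\<^sub>v v) $ i\<bar> + \<bar>(D ^\<^sub>m k *\<^sub>v w) $ i\<bar>"
            using carrier_matD[OF Dk[of k]] by (auto simp del: index_mult_mat_vec)
        qed
        then show ?thesis
          using q by (simp add: S_def sum.distrib divide_right_mono flip: add_divide_distrib)
      qed
      then show "S (v + w) k \<le> p v + p w" using S_le_p[OF v, of k] S_le_p[OF w, of k] by linarith
    qed simp
  qed
  then show ?thesis using q by (meson max.cobounded1)
qed

section \<open>Perturbation of one Runge--Kutta step\<close>

lemma weighted_products_perturbation:
  fixes \<omega> g G w W :: "nat \<Rightarrow> real"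
  assumes \<omega>: "(\<Sum>j<s. \<bar>\<omega> j\<bar>) \<le> a" and "s > 0"
    and g: "\<And>j. j < s \<Longrightarrow> \<bar>g j\<bar> \<le> K" and R: "\<And>j. j < s \<Longrightarrow> \<bar>W j\<bar> \<le> R"
    and e: "\<And>j. j < s \<Longrightarrow> \<bar>g j - G j\<bar> \<le> e" and Z: "\<And>j. j < s \<Longrightarrow> \<bar>W j - w j\<bar> \<le> Z"
  shows "\<bar>(\<Sum>j<s. \<omega> j * (G j * W j)) - (\<Sum>j<s. \<omega> j * g j * w j)\<bar> \<le> a * (R * e + K * Z)"
proof -
  have nonneg: "0 \<le> K" "0 \<le> R" "0 \<le> e" "0 \<le> Z"
    using g[OF \<open>s > 0\<close>] R[OF \<open>s > 0\<close>] e[OF \<open>s > 0\<close>] Z[OF \<open>s > 0\<close>] by linarith+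
  have "\<bar>(\<Sum>j<s. \<omega> j * (G j * W j)) - (\<Sum>j<s. \<omega> j * g j * w j)\<bar>
      \<le> (\<Sum>j<s. \<bar>\<omega> j\<bar> * (R * e + K * Z))"
    unfolding sum_subtractf[symmetric]
  proof (rule order_trans[OF sum_abs], rule sum_mono)
    fix j assume "j \<in> {..<s}"
    then have j: "j < s" by simp
    have "G j * W j - g j * w j = (G j - g j) * W j + g j * (W j - w j)" by (simp add: algebra_simps)
    also have "\<bar>\<dots>\<bar> \<le> e * R + K * Z"
      using e[OF j] R[OF j] g[OF j] Z[OF j] nonneg
      by (intro order_trans[OF abs_triangle_ineq] add_mono) (auto simp: abs_mult intro!: mult_mono)
    finally have "\<bar>\<omega> j\<bar> * \<bar>G j * W j - g j * w j\<bar> \<le> \<bar>\<omega> j\<bar> * (R * e + K * Z)"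
      by (intro mult_left_mono) (auto simp: mult_ac)
    then show "\<bar>\<omega> j * (G j * W j) - \<omega> j * g j * w j\<bar> \<le> \<bar>\<omega> j\<bar> * (R * e + K * Z)"
      by (simp add: mult.assoc abs_mult flip: right_diff_distrib)
  qed
  also have "\<dots> \<le> a * (R * e + K * Z)"
    unfolding sum_distrib_right[symmetric] using \<omega> nonneg by (intro mult_right_mono) auto
  finally show ?thesis .
qed

text \<open>Here \<open>w\<close> are the computed stages and \<open>W\<close> the exact ones, which satisfy the stage equations with
  coefficients \<open>G\<close> up to the defect \<open>d\<close>. The largest stage error reappears on the right-hand side
  with the factor \<open>h a K \<le> 1/2\<close> and is absorbed.\<close>

lemma stage_perturbation:
  fixes \<alpha> :: "nat \<Rightarrow> nat \<Rightarrow> real"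
  assumes w: "\<And>i. i < s \<Longrightarrow> w i = x + h * (\<Sum>j<s. \<alpha> i j * g j * w j)"
    and W: "\<And>i. i < s \<Longrightarrow> \<bar>W i - (X + h * (\<Sum>j<s. \<alpha> i j * (G j * W j)))\<bar> \<le> d"
    and \<alpha>: "\<And>i. i < s \<Longrightarrow> (\<Sum>j<s. \<bar>\<alpha> i j\<bar>) \<le> a"
    and g: "\<And>j. j < s \<Longrightarrow> \<bar>g j\<bar> \<le> K" and R: "\<And>j. j < s \<Longrightarrow> \<bar>W j\<bar> \<le> R"
    and e: "\<And>j. j < s \<Longrightarrow> \<bar>g j - G j\<bar> \<le> e"
    and h: "0 \<le> h" "h * a * K \<le> 1 / 2" and i: "i < s"
  shows "\<bar>W i - w i\<bar> \<le> 2 * (\<bar>X - x\<bar> + h * a * R * e + d)"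
proof -
  define Z where "Z = Max ((\<lambda>i. \<bar>W i - w i\<bar>) ` {..<s})"
  have Zi: "\<bar>W j - w j\<bar> \<le> Z" if "j < s" for j unfolding Z_def using that by (intro Max_ge) auto
  have Z0: "0 \<le> Z" using Zi[OF i] by linarith
  have main: "\<bar>W k - w k\<bar> \<le> d + \<bar>X - x\<bar> + h * a * R * e + Z / 2" if k: "k < s" for k
  proof -
    have "\<bar>(\<Sum>j<s. \<alpha> k j * (G j * W j)) - (\<Sum>j<s. \<alpha> k j * g j * w j)\<bar> \<le> a * (R * e + K * Z)"
      using i by (intro weighted_products_perturbation \<alpha> k g R e Zi) auto
    then have "h * \<bar>(\<Sum>j<s. \<alpha> k j * (G j * W j)) - (\<Sum>j<s. \<alpha> k j * g j * w j)\<bar>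
        \<le> h * (a * (R * e + K * Z))" using h by (intro mult_left_mono) auto
    also have "\<dots> = h * a * R * e + (h * a * K) * Z" by (simp add: algebra_simps)
    also have "\<dots> \<le> h * a * R * e + 1 / 2 * Z"
      using h Z0 by (intro add_left_mono mult_right_mono) auto
    finally have "\<bar>h * (\<Sum>j<s. \<alpha> k j * (G j * W j)) - h * (\<Sum>j<s. \<alpha> k j * g j * w j)\<bar>
        \<le> h * a * R * e + 1 / 2 * Z"
      using h(1) by (simp add: abs_mult flip: right_diff_distrib)
    then show ?thesis using W[OF k] w[OF k] by linarith
  qed
  have "Z \<in> (\<lambda>i. \<bar>W i - w i\<bar>) ` {..<s}" unfolding Z_def using i by (intro Max_in) auto
  then obtain k where "k < s" "Z = \<bar>W k - w k\<bar>" by auto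
  then have "Z \<le> 2 * (\<bar>X - x\<bar> + h * a * R * e + d)" using main[of k] by simp
  then show ?thesis using Zi[OF i] by linarith
qed

text \<open>The final update turns the stage errors into an amplification \<open>1 + O(h)\<close> of the incoming error; the
  error \<open>e\<close> of the coefficients enters with a factor \<open>h\<close>, the defect \<open>d\<close> without one.\<close>

lemma rk_step_perturbation:
  fixes \<alpha> :: "nat \<Rightarrow> nat \<Rightarrow> real"
  assumes w: "\<And>i. i < s \<Longrightarrow> w i = x + h * (\<Sum>j<s. \<alpha> i j * g j * w j)"
    and W: "\<And>i. i < s \<Longrightarrow> \<bar>W i - (X + h * (\<Sum>j<s. \<alpha> i j * (G j * W j)))\<bar> \<le> d"
    and Y: "\<bar>Y - (X + h * (\<Sum>j<s. \<beta> j * (G j * W j)))\<bar> \<le> d"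
    and \<alpha>: "\<And>i. i < s \<Longrightarrow> (\<Sum>j<s. \<bar>\<alpha> i j\<bar>) \<le> a" and \<beta>: "(\<Sum>j<s. \<bar>\<beta> j\<bar>) \<le> a"
    and g: "\<And>j. j < s \<Longrightarrow> \<bar>g j\<bar> \<le> K" and R: "\<And>j. j < s \<Longrightarrow> \<bar>W j\<bar> \<le> R"
    and e: "\<And>j. j < s \<Longrightarrow> \<bar>g j - G j\<bar> \<le> e"
    and h: "0 \<le> h" "h * a * K \<le> 1 / 2" and "s > 0"
  shows "\<bar>Y - (x + h * (\<Sum>j<s. \<beta> j * g j * w j))\<bar>
     \<le> \<bar>X - x\<bar> + h * (2 * a * K * \<bar>X - x\<bar> + 2 * a * R * e) + 2 * d"
proof -
  have R0: "0 \<le> R" using R[OF \<open>s > 0\<close>] by linarith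
  have e0: "0 \<le> e" using e[OF \<open>s > 0\<close>] by linarith
  have d0: "0 \<le> d" using Y by linarith
  have a0: "0 \<le> a" using \<beta> by (meson abs_ge_zero order_trans sum_nonneg)
  define Z where "Z = 2 * (\<bar>X - x\<bar> + h * a * R * e + d)"
  have Zj: "\<bar>W j - w j\<bar> \<le> Z" if "j < s" for j
    unfolding Z_def by (rule stage_perturbation[OF w W \<alpha> g R e h that])
  have "\<bar>(\<Sum>j<s. \<beta> j * (G j * W j)) - (\<Sum>j<s. \<beta> j * g j * w j)\<bar> \<le> a * (R * e + K * Z)"
    by (rule weighted_products_perturbation[OF \<beta> \<open>s > 0\<close> g R e Zj])
  then have "h * \<bar>(\<Sum>j<s. \<beta> j * (G j * W j)) - (\<Sum>j<s. \<beta> j * g j * w j)\<bar>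
      \<le> h * (a * (R * e + K * Z))" using h by (intro mult_left_mono) auto
  also have "\<dots> = h * (a * R * e) + h * (2 * a * K * \<bar>X - x\<bar>) + h * a * K * (2 * (h * (a * R * e) + d))"
    by (simp add: Z_def algebra_simps)
  also have "\<dots> \<le> h * (a * R * e) + h * (2 * a * K * \<bar>X - x\<bar>) + 1 / 2 * (2 * (h * (a * R * e) + d))"
    using h a0 R0 e0 d0 by (intro add_left_mono mult_right_mono[OF h(2)]) auto
  also have "\<dots> = h * (2 * a * K * \<bar>X - x\<bar> + 2 * a * R * e) + d" by (simp add: algebra_simps)
  finally have "\<bar>h * (\<Sum>j<s. \<beta> j * (G j * W j)) - h * (\<Sum>j<s. \<beta> j * g j * w j)\<bar>
      \<le> h * (2 * a * K * \<bar>X - x\<bar> + 2 * a * R * e) + d"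
    using h(1) by (simp add: abs_mult flip: right_diff_distrib)
  then show ?thesis using Y by linarith
qed

text \<open>Uniqueness is the perturbation estimate between two solutions. The system is square and linear, so
  uniqueness for the zero right-hand side already makes its matrix invertible.\<close>

lemma stage_solution_unique_exists:
  assumes \<alpha>: "\<And>i. i < s \<Longrightarrow> (\<Sum>j<s. \<bar>A $$ (i, j)\<bar>) \<le> a"
    and g: "\<And>j. j < s \<Longrightarrow> \<bar>g $ j\<bar> \<le> K"
    and h: "0 \<le> h" "h * a * K \<le> 1 / 2"
  shows "\<exists>!w. stage_solution s A h x g w"
proof -
  have unique: "w $ i = w' $ i"
    if "stage_solution s A h y g w" "stage_solution s A h y g w'" "i < s" for y w w' i
  proof -
    have "\<bar>w' $ i - w $ i\<bar> \<le> 2 * (\<bar>y - y\<bar> + h * a * (\<Sum>j<s. \<bar>w' $ j\<bar>) * 0 + 0)"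
    proof (rule stage_perturbation[where K = K and g = "\<lambda>j. g $ j" and G = "\<lambda>j. g $ j"
          and \<alpha> = "\<lambda>i j. A $$ (i, j)"])
      show "\<bar>w' $ j\<bar> \<le> (\<Sum>j<s. \<bar>w' $ j\<bar>)" if "j < s" for j
        using that by (intro member_le_sum[of j "{..<s}" "\<lambda>j. \<bar>w' $ j\<bar>"]) auto
      show "w $ k = y + h * (\<Sum>j<s. A $$ (k, j) * g $ j * w $ j)" if "k < s" for k
        using \<open>stage_solution s A h y g w\<close> that unfolding stage_solution_def by blast
      show "\<bar>w' $ k - (y + h * (\<Sum>j<s. A $$ (k, j) * (g $ j * w' $ j)))\<bar> \<le> 0" if "k < s" for k
      proof -
        have "w' $ k = y + h * (\<Sum>j<s. A $$ (k, j) * g $ j * w' $ j)"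
          using \<open>stage_solution s A h y g w'\<close> that unfolding stage_solution_def by blast
        then show ?thesis by (simp only: mult.assoc)
      qed
    qed (use \<alpha> g h \<open>i < s\<close> in auto)
    then show ?thesis by simp
  qed
  define M where "M = Matrix.mat s s (\<lambda>(i, j). (if i = j then 1 else 0) - h * (A $$ (i, j) * g $ j))"
  have M: "M \<in> carrier_mat s s" by (simp add: M_def)
  have Mw: "(M *\<^sub>v w) $ i = w $ i - h * (\<Sum>j<s. A $$ (i, j) * g $ j * w $ j)"
    if "w \<in> carrier_vec s" "i < s" for w i
  proof -
    have "(M *\<^sub>v w) $ i = (\<Sum>j<s. (if i = j then w $ j else 0) - h * (A $$ (i, j) * g $ j * w $ j))"
      using that by (auto simp: M_def scalar_prod_def atLeast0LessThan algebra_simps intro!: sum.cong)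
    also have "\<dots> = w $ i - h * (\<Sum>j<s. A $$ (i, j) * g $ j * w $ j)"
      using that by (simp add: sum_subtractf sum_distrib_left)
    finally show ?thesis .
  qed
  have sol_iff: "stage_solution s A h y g w \<longleftrightarrow> M *\<^sub>v w = Matrix.vec s (\<lambda>_. y)"
    if w: "w \<in> carrier_vec s" for w y
  proof -
    have "M *\<^sub>v w = Matrix.vec s (\<lambda>_. y) \<longleftrightarrow> (\<forall>i<s. (M *\<^sub>v w) $ i = y)"
      using M by (auto simp: vec_eq_iff simp del: index_mult_mat_vec)
    moreover have "(M *\<^sub>v w) $ i = y \<longleftrightarrow> w $ i = y + h * (\<Sum>j<s. A $$ (i, j) * g $ j * w $ j)"
      if "i < s" for i
      by (simp only: Mw[OF w that] diff_eq_eq)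
    ultimately show ?thesis using w unfolding stage_solution_def by blast
  qed
  have "det M \<noteq> 0"
  proof
    assume "det M = 0"
    then obtain v where v: "v \<in> carrier_vec s" "v \<noteq> 0\<^sub>v s" "M *\<^sub>v v = 0\<^sub>v s"
      using det_0_iff_vec_prod_zero_field[OF M] by auto
    then have "stage_solution s A h 0 g v" by (auto simp: sol_iff zero_vec_def)
    moreover have "stage_solution s A h 0 g (0\<^sub>v s)" by (auto simp: stage_solution_def)
    ultimately have "v $ i = 0\<^sub>v s $ i" if "i < s" for i using unique that by blast
    then show False using v by (auto simp: vec_eq_iff)
  qed
  then obtain B where B: "B \<in> carrier_mat s s" "M * B = 1\<^sub>m s"
    using det_non_zero_imp_unit[OF M, of "()"] by (auto simp: Units_def ring_mat_def)
  define w where "w = B *\<^sub>v Matrix.vec s (\<lambda>_. x)"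
  have w: "w \<in> carrier_vec s" using B by (simp add: w_def)
  have "M *\<^sub>v w = Matrix.vec s (\<lambda>_. x)"
    unfolding w_def using B M assoc_mult_mat_vec[of M s s B s "Matrix.vec s (\<lambda>_. x)"] by auto
  then have "stage_solution s A h x g w" using sol_iff[OF w] by simp
  moreover have "w' = w" if "stage_solution s A h x g w'" for w'
  proof (rule eq_vecI)
    have "w' \<in> carrier_vec s" using that unfolding stage_solution_def by blast
    then show "dim_vec w' = dim_vec w" using w by simp
    show "w' $ i = w $ i" if "i < dim_vec w" for i
      using unique[OF \<open>stage_solution s A h x g w'\<close> \<open>stage_solution s A h x g w\<close>] that w by simp
  qed
  ultimately show ?thesis by blast
qed

section \<open>Error propagation through the scheme\<close>

lemma scheme_gamma_prev_Suc:
  "scheme_gamma_prev s N A b D \<theta> h x0 g0 (Suc n)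
     = step_update N D \<theta> (scheme_u s N A b D \<theta> h x0 g0 n) (scheme_gamma_prev s N A b D \<theta> h x0 g0 n)"
  by (simp add: scheme_gamma_prev_def scheme_u_def Let_def split_beta)

lemma scheme_u_Suc:
  fixes s N A b D \<theta> h x0 g0 n
  defines "x \<equiv> scheme_u s N A b D \<theta> h x0 g0 n"
    and "g' \<equiv> scheme_gamma_prev s N A b D \<theta> h x0 g0 (Suc n)"
  shows "scheme_u s N A b D \<theta> h x0 g0 (Suc n)
     = x + h * (\<Sum>i<s. b $ i * g' $ i * (THE w. stage_solution s A h x g' w) $ i)"
  unfolding x_def g'_def scheme_gamma_prev_Suc
  by (simp add: scheme_u_def scheme_gamma_prev_def Let_def split_beta)

lemma one_plus_power_le_exp:
  fixes x :: real
  assumes "0 \<le> x"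
  shows "(1 + x) ^ n \<le> exp (real n * x)"
proof -
  have "(1 + x) ^ n \<le> exp x ^ n"
    using assms by (intro power_mono exp_ge_add_one_self) auto
  then show ?thesis by (simp add: exp_of_nat_mult)
qed

text \<open>The data of one fixed step size \<open>h\<close>, with every analytic fact about \<open>u\<close> and \<open>N\<close> reduced to a numerical
  bound on the time interval \<open>[0, T']\<close>. The number \<open>L\<close> is the ratio allowed between the error of the
  \<open>\<gamma>\<close>'s, measured by \<open>p\<close>, and the error of \<open>u\<close>: the first inequality for \<open>L\<close> says that the contraction
  \<open>q\<close> compensates what one step adds to the former, the second that the initial errors respect the ratio.\<close>

locale consistent_scheme =
  fixes \<Omega> :: "real set" and N u :: "real \<Rightarrow> real" and s :: nat and c b \<theta> :: "real vec" and A D :: "real mat"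
    and p :: "real vec \<Rightarrow> real" and q \<kappa> h T' r a \<tau> \<Lambda> M' K R k1 k2 L :: real
  assumes s: "s > 0" and D: "D \<in> carrier_mat s s" and \<theta>: "\<theta> \<in> carrier_vec s"
    and h: "0 < h"
    and p: "adapted_norm s D q \<kappa> p"
    and nonneg: "0 \<le> q" "0 \<le> \<kappa>" "0 \<le> \<Lambda>" "0 \<le> K" "0 \<le> R" "0 \<le> k1" "0 \<le> k2"
    and A_rows: "\<And>i. i < s \<Longrightarrow> (\<Sum>j<s. \<bar>A $$ (i, j)\<bar>) \<le> a" and b_sum: "(\<Sum>j<s. \<bar>b $ j\<bar>) \<le> a"
    and \<theta>_bound: "\<And>i. i < s \<Longrightarrow> \<bar>\<theta> $ i\<bar> \<le> \<tau>"
    and h_small: "h * a * K \<le> 1 / 2"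
    and near: "\<And>t x. t \<in> {0..T'} \<Longrightarrow> \<bar>u t - x\<bar> < r \<Longrightarrow> x \<in> \<Omega> \<and> \<bar>N x - N (u t)\<bar> \<le> \<Lambda> * \<bar>u t - x\<bar>"
    and N_bound: "\<And>t j. t \<in> {0..T'} \<Longrightarrow> j < s \<Longrightarrow> \<bar>N (u (t + c $ j * h))\<bar> \<le> M'"
    and u_bound: "\<And>t j. t \<in> {0..T'} \<Longrightarrow> j < s \<Longrightarrow> \<bar>u (t + c $ j * h)\<bar> \<le> R"
    and step_cons: "\<And>t i. t \<in> {0..T'} \<Longrightarrow> i < s \<Longrightarrow>
      \<bar>N (u (t + c $ i * h)) - ((\<Sum>j<s. D $$ (i, j) * N (u (t - h + c $ j * h))) + N (u t) * \<theta> $ i)\<bar> \<le> k1 * h ^ s"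
    and stage_cons: "\<And>t i. t \<in> {0..T'} \<Longrightarrow> i < s \<Longrightarrow>
      \<bar>u (t + c $ i * h) - (u t + h * (\<Sum>j<s. A $$ (i, j) * (N (u (t + c $ j * h)) * u (t + c $ j * h))))\<bar> \<le> k2 * h ^ Suc s"
    and final_cons: "\<And>t. t \<in> {0..T'} \<Longrightarrow>
      \<bar>u (t + h) - (u t + h * (\<Sum>j<s. b $ j * (N (u (t + c $ j * h)) * u (t + c $ j * h))))\<bar> \<le> k2 * h ^ Suc s"
    and L: "q * L + \<kappa> * (\<tau> * \<Lambda> + k1) \<le> L" "\<kappa> \<le> L"
begin

lemma p_upper: "v \<in> carrier_vec s \<Longrightarrow> i < s \<Longrightarrow> \<bar>v $ i\<bar> \<le> p v"
  and p_lower: "v \<in> carrier_vec s \<Longrightarrow> (\<And>i. i < s \<Longrightarrow> \<bar>v $ i\<bar> \<le> B) \<Longrightarrow> p v \<le> \<kappa> * B"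
  and p_contract: "v \<in> carrier_vec s \<Longrightarrow> p (D *\<^sub>v v) \<le> q * p v"
  and p_triangle: "v \<in> carrier_vec s \<Longrightarrow> w \<in> carrier_vec s \<Longrightarrow> p (v + w) \<le> p v + p w"
  using p unfolding adapted_norm_def by blast+

text \<open>At time \<open>t = n h\<close> the current vector \<open>g\<close> is \<open>\<gamma>\<^bsub>n-1+c_i\<^esub>\<close>, which lags one step behind; hence the
  comparison at \<open>t - h + c\<^sub>i h\<close>.\<close>

definition \<gamma>_error :: "real \<Rightarrow> real vec \<Rightarrow> real vec" where
  "\<gamma>_error t g = Matrix.vec s (\<lambda>i. g $ i - N (u (t - h + c $ i * h)))"

text \<open>The three terms are the contributions of the error of \<open>u\<close>, of the error of the \<open>\<gamma>\<close>'s and of the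
  consistency defects to the error after one Runge--Kutta step.\<close>

definition growth :: real where "growth = 2 * a * K + 2 * a * R * L + 2 * k2"

lemma \<gamma>_error_carrier [simp]: "\<gamma>_error t g \<in> carrier_vec s"
  by (simp add: \<gamma>_error_def)

lemma a_nonneg: "0 \<le> a"
  using b_sum by (meson abs_ge_zero order_trans sum_nonneg)

lemma growth_nonneg: "0 \<le> growth"
  using a_nonneg nonneg L(2) by (auto simp: growth_def intro!: add_nonneg_nonneg mult_nonneg_nonneg)

text \<open>The invariant of the induction over the time steps. A common bound \<open>B\<close> for the error of \<open>u\<close> and, up to
  the factor \<open>L\<close>, for the error of the \<open>\<gamma>\<close>'s grows only by \<open>1 + O(h)\<close>: the \<open>\<gamma>\<close>-error stays below
  \<open>L B\<close> by contraction, and it then enters the new value of \<open>u\<close> with a factor \<open>h\<close>. The conditions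
  \<open>B < r\<close> and \<open>M' + L B \<le> K\<close> keep the scheme where \<open>N\<close> is Lipschitz and the stage system is solvable.\<close>

lemma one_step:
  fixes x :: real and g :: "real vec"
  defines "g' \<equiv> step_update N D \<theta> x g"
  assumes t: "t \<in> {0..T'}" and g: "g \<in> carrier_vec s"
    and B: "\<bar>u t - x\<bar> \<le> B" "p (\<gamma>_error t g) \<le> L * B" "h ^ s \<le> B" "B < r" "M' + L * B \<le> K"
  shows "x \<in> \<Omega>" and "g' \<in> carrier_vec s" and "p (\<gamma>_error (t + h) g') \<le> L * B"
    and "\<exists>!w. stage_solution s A h x g' w"
    and "\<bar>u (t + h) - (x + h * (\<Sum>j<s. b $ j * g' $ j * (THE w. stage_solution s A h x g' w) $ j))\<bar>
      \<le> (1 + growth * h) * B"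
proof -
  have B0: "0 \<le> B" using B(1) by linarith
  have lip: "\<bar>N x - N (u t)\<bar> \<le> \<Lambda> * B"
    using near[OF t, of x] B nonneg by (meson le_less_trans mult_left_mono order_trans)
  show "x \<in> \<Omega>" using near[OF t, of x] B by linarith
  show g': "g' \<in> carrier_vec s" using D \<theta> g by (simp add: g'_def step_update_def)
  have g'_nth: "g' $ i = (\<Sum>j<s. D $$ (i, j) * g $ j) + N x * \<theta> $ i" if "i < s" for i
    using that carrier_matD[OF D] carrier_vecD[OF \<theta>] carrier_vecD[OF g]
    by (simp add: g'_def step_update_def scalar_prod_def atLeast0LessThan)
  \<comment> \<open>The source term in the recursion for the \<open>\<gamma>\<close>-error: the effect of the error of \<open>u\<close>, minus the defect
    of the exact values.\<close>
  define \<delta> where "\<delta> = Matrix.vec s (\<lambda>i. \<theta> $ i * (N x - N (u t))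
     - (N (u (t + c $ i * h)) - ((\<Sum>j<s. D $$ (i, j) * N (u (t - h + c $ j * h))) + N (u t) * \<theta> $ i)))"
  have \<delta>: "\<delta> \<in> carrier_vec s" by (simp add: \<delta>_def)
  have "\<gamma>_error (t + h) g' = D *\<^sub>v \<gamma>_error t g + \<delta>"
  proof (rule eq_vecI)
    fix i assume "i < dim_vec (D *\<^sub>v \<gamma>_error t g + \<delta>)"
    then have i: "i < s" by (simp add: \<delta>_def)
    have "(D *\<^sub>v \<gamma>_error t g) $ i = (\<Sum>j<s. D $$ (i, j) * g $ j - D $$ (i, j) * N (u (t - h + c $ j * h)))"
      using i carrier_matD[OF D] by (simp add: \<gamma>_error_def scalar_prod_def atLeast0LessThan right_diff_distrib)
    moreover have "\<gamma>_error (t + h) g' $ i = g' $ i - N (u (t + c $ i * h))"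
      using i by (simp add: \<gamma>_error_def)
    ultimately show "\<gamma>_error (t + h) g' $ i = (D *\<^sub>v \<gamma>_error t g + \<delta>) $ i"
      using i carrier_matD[OF D] g'_nth[OF i]
      by (simp add: \<delta>_def sum_subtractf algebra_simps del: index_mult_mat_vec)
  qed (simp add: \<gamma>_error_def \<delta>_def)
  then have "p (\<gamma>_error (t + h) g') \<le> p (D *\<^sub>v \<gamma>_error t g) + p \<delta>"
    using p_triangle[OF _ \<delta>, of "D *\<^sub>v \<gamma>_error t g"] D by simp
  also have "p (D *\<^sub>v \<gamma>_error t g) \<le> q * (L * B)"
    using p_contract[of "\<gamma>_error t g"] B(2) nonneg by (meson \<gamma>_error_carrier mult_left_mono order_trans)
  also have "p \<delta> \<le> \<kappa> * ((\<tau> * \<Lambda> + k1) * B)"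
  proof (rule p_lower[OF \<delta>])
    fix i assume i: "i < s"
    have "\<bar>\<theta> $ i * (N x - N (u t))\<bar> \<le> \<tau> * (\<Lambda> * B)"
      unfolding abs_mult using \<theta>_bound[OF i] lip by (intro mult_mono) auto
    moreover have "k1 * h ^ s \<le> k1 * B" using B(3) nonneg by (intro mult_left_mono) auto
    ultimately show "\<bar>\<delta> $ i\<bar> \<le> (\<tau> * \<Lambda> + k1) * B"
      using step_cons[OF t i] i unfolding \<delta>_def distrib_right by (simp add: mult.assoc)
  qed
  also have "q * (L * B) + \<kappa> * ((\<tau> * \<Lambda> + k1) * B) = (q * L + \<kappa> * (\<tau> * \<Lambda> + k1)) * B"
    by (simp add: algebra_simps)
  also have "\<dots> \<le> L * B" using L(1) B0 by (intro mult_right_mono)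
  finally show p': "p (\<gamma>_error (t + h) g') \<le> L * B" by simp
  have e: "\<bar>g' $ j - N (u (t + c $ j * h))\<bar> \<le> L * B" if "j < s" for j
    using p_upper[of "\<gamma>_error (t + h) g'" j] p' that by (simp add: \<gamma>_error_def)
  have gK: "\<bar>g' $ j\<bar> \<le> K" if "j < s" for j
    using e[OF that] N_bound[OF t that] B(5) by linarith
  show ex: "\<exists>!w. stage_solution s A h x g' w"
    using A_rows gK h h_small by (intro stage_solution_unique_exists) auto
  define w where "w = (THE w. stage_solution s A h x g' w)"
  have w: "stage_solution s A h x g' w" unfolding w_def by (rule theI'[OF ex])
  have "\<bar>u (t + h) - (x + h * (\<Sum>j<s. b $ j * g' $ j * w $ j))\<bar>
    \<le> \<bar>u t - x\<bar> + h * (2 * a * K * \<bar>u t - x\<bar> + 2 * a * R * (L * B)) + 2 * (k2 * h ^ Suc s)"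
  proof (rule rk_step_perturbation[where \<alpha> = "\<lambda>i j. A $$ (i, j)"
        and W = "\<lambda>j. u (t + c $ j * h)" and G = "\<lambda>j. N (u (t + c $ j * h))"])
    show "w $ i = x + h * (\<Sum>j<s. A $$ (i, j) * g' $ j * w $ j)" if "i < s" for i
      using w that unfolding stage_solution_def by blast
  qed (use stage_cons[OF t] final_cons[OF t] A_rows b_sum gK u_bound[OF t] e h h_small s in auto)
  also have "\<dots> \<le> B + h * (2 * a * K * B + 2 * a * R * (L * B)) + 2 * (k2 * (h * B))"
  proof -
    have "2 * a * K * \<bar>u t - x\<bar> \<le> 2 * a * K * B"
      using B(1) a_nonneg nonneg by (intro mult_left_mono) auto
    moreover have "k2 * h ^ Suc s \<le> k2 * (h * B)"
      using B(3) h nonneg by (auto intro!: mult_left_mono)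
    moreover have "h * (2 * a * K * \<bar>u t - x\<bar> + 2 * a * R * (L * B))
        \<le> h * (2 * a * K * B + 2 * a * R * (L * B))" if "2 * a * K * \<bar>u t - x\<bar> \<le> 2 * a * K * B"
      by (rule mult_left_mono[OF add_right_mono[OF that]]) (use h in simp)
    ultimately show ?thesis using B(1) by linarith
  qed
  also have "\<dots> = (1 + growth * h) * B" by (simp add: growth_def algebra_simps)
  finally show "\<bar>u (t + h) - (x + h * (\<Sum>j<s. b $ j * g' $ j * (THE w. stage_solution s A h x g' w) $ j))\<bar>
      \<le> (1 + growth * h) * B" unfolding w_def .
qed

context
  fixes u0 \<epsilon>0 :: real and g0 :: "real vec"
  assumes g0: "g0 \<in> carrier_vec s"
    and \<epsilon>0: "\<forall>i<s. \<bar>g0 $ i - N (u (- h + c $ i * h))\<bar> \<le> \<epsilon>0"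
    and small_r: "exp (growth * T') * (\<bar>u 0 - u0\<bar> + \<epsilon>0 + h ^ s) < r"
    and small_m: "M' + L * (exp (growth * T') * (\<bar>u 0 - u0\<bar> + \<epsilon>0 + h ^ s)) \<le> K"
begin

abbreviation "scheme \<equiv> scheme_u s N A b D \<theta> h u0 g0"
abbreviation "\<gamma>_prev \<equiv> scheme_gamma_prev s N A b D \<theta> h u0 g0"

definition error_bound :: "nat \<Rightarrow> real" where
  "error_bound n = (1 + growth * h) ^ n * (\<bar>u 0 - u0\<bar> + \<epsilon>0 + h ^ s)"

lemma initial_error_nonneg: "0 \<le> \<epsilon>0"
  using \<epsilon>0 s abs_ge_zero order_trans by blast

lemma error_bound_ge: "\<bar>u 0 - u0\<bar> + \<epsilon>0 + h ^ s \<le> error_bound n"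
proof -
  have "1 * (\<bar>u 0 - u0\<bar> + \<epsilon>0 + h ^ s) \<le> error_bound n"
    unfolding error_bound_def using growth_nonneg h initial_error_nonneg
    by (intro mult_right_mono one_le_power) auto
  then show ?thesis by simp
qed

lemma error_bound_le_exp: "error_bound n \<le> exp (growth * (real n * h)) * (\<bar>u 0 - u0\<bar> + \<epsilon>0 + h ^ s)"
  unfolding error_bound_def
  using one_plus_power_le_exp[of "growth * h" n] growth_nonneg h initial_error_nonneg
  by (intro mult_right_mono) (auto simp: mult_ac)

lemma error_bound_le_final:
  assumes "real n * h \<le> T'"
  shows "error_bound n \<le> exp (growth * T') * (\<bar>u 0 - u0\<bar> + \<epsilon>0 + h ^ s)"
proof -
  have "exp (growth * (real n * h)) * (\<bar>u 0 - u0\<bar> + \<epsilon>0 + h ^ s)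
      \<le> exp (growth * T') * (\<bar>u 0 - u0\<bar> + \<epsilon>0 + h ^ s)"
    using assms growth_nonneg h initial_error_nonneg by (intro mult_right_mono) (auto intro: mult_left_mono)
  then show ?thesis using error_bound_le_exp[of n] by linarith
qed

text \<open>Induction over the steps with the invariant of one step. The bound only grows by a power of
  \<open>1 + growth h\<close>, hence stays below its exponential, and the smallness of the initial errors
  rules out that the hypotheses of a step fail before \<open>T'\<close>.\<close>

lemma scheme_error:
  assumes "real n * h \<le> T'"
  shows "\<bar>u (real n * h) - scheme n\<bar> \<le> error_bound n"
    and "p (\<gamma>_error (real n * h) (\<gamma>_prev n)) \<le> L * error_bound n"
    and "\<gamma>_prev n \<in> carrier_vec s"
    and "scheme n \<in> \<Omega>" and "\<exists>!w. stage_solution s A h (scheme n) (\<gamma>_prev (Suc n)) w"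
proof -
  have step: "scheme n \<in> \<Omega>" "\<gamma>_prev (Suc n) \<in> carrier_vec s"
      "p (\<gamma>_error (real (Suc n) * h) (\<gamma>_prev (Suc n))) \<le> L * error_bound n"
      "\<exists>!w. stage_solution s A h (scheme n) (\<gamma>_prev (Suc n)) w"
      "\<bar>u (real (Suc n) * h) - scheme (Suc n)\<bar> \<le> error_bound (Suc n)"
    if n: "real n * h \<le> T'" and inv: "\<bar>u (real n * h) - scheme n\<bar> \<le> error_bound n"
      "p (\<gamma>_error (real n * h) (\<gamma>_prev n)) \<le> L * error_bound n" "\<gamma>_prev n \<in> carrier_vec s" for n
  proof -
    have t: "real n * h \<in> {0..T'}" using n h by simp
    have hs: "h ^ s \<le> error_bound n" using error_bound_ge[of n] initial_error_nonneg by linarith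
    have r: "error_bound n < r" using error_bound_le_final[OF n] small_r by linarith
    have "L * error_bound n \<le> L * (exp (growth * T') * (\<bar>u 0 - u0\<bar> + \<epsilon>0 + h ^ s))"
      using error_bound_le_final[OF n] L(2) nonneg by (intro mult_left_mono) auto
    then have K: "M' + L * error_bound n \<le> K" using small_m by linarith
    have Suc: "real (Suc n) * h = real n * h + h" by (simp add: algebra_simps)
    have bound_Suc: "error_bound (Suc n) = (1 + growth * h) * error_bound n" by (simp add: error_bound_def)
    note one = one_step[OF t inv(3,1,2) hs r K, folded scheme_gamma_prev_Suc Suc]
    show "scheme n \<in> \<Omega>" "\<gamma>_prev (Suc n) \<in> carrier_vec s"
      "p (\<gamma>_error (real (Suc n) * h) (\<gamma>_prev (Suc n))) \<le> L * error_bound n"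
      "\<exists>!w. stage_solution s A h (scheme n) (\<gamma>_prev (Suc n)) w"
      by (fact one)+
    show "\<bar>u (real (Suc n) * h) - scheme (Suc n)\<bar> \<le> error_bound (Suc n)"
      using one(5) unfolding scheme_u_Suc bound_Suc .
  qed
  have inv: "\<bar>u (real n * h) - scheme n\<bar> \<le> error_bound n
      \<and> p (\<gamma>_error (real n * h) (\<gamma>_prev n)) \<le> L * error_bound n \<and> \<gamma>_prev n \<in> carrier_vec s"
    using assms
  proof (induction n)
    case 0
    have "p (\<gamma>_error 0 g0) \<le> \<kappa> * \<epsilon>0"
      using \<epsilon>0 by (intro p_lower) (auto simp: \<gamma>_error_def)
    also have "\<dots> \<le> L * error_bound 0"
    proof (intro mult_mono)
      show "\<epsilon>0 \<le> error_bound 0"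
        using error_bound_ge[of 0] zero_le_power[of h s] h by linarith
    qed (use initial_error_nonneg nonneg L(2) in auto)
    finally show ?case
      using error_bound_ge[of 0] initial_error_nonneg g0 h
      by (auto simp: scheme_u_def scheme_gamma_prev_def intro: order_trans[rotated])
  next
    case (Suc n)
    have n: "real n * h \<le> T'"
      using Suc.prems h by (simp add: algebra_simps)
    note IH = Suc.IH[OF n]
    have "L * error_bound n \<le> L * error_bound (Suc n)"
    proof -
      have "0 \<le> error_bound n" using error_bound_ge[of n] initial_error_nonneg h
        by (smt (verit) zero_le_power)
      then have "1 * error_bound n \<le> (1 + growth * h) * error_bound n"
        using growth_nonneg h by (intro mult_right_mono) auto
      then show ?thesis using L(2) nonneg by (intro mult_left_mono) (auto simp: error_bound_def)
    qed
    then show ?case using step[OF n] IH by (meson order_trans)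
  qed
  then show "\<bar>u (real n * h) - scheme n\<bar> \<le> error_bound n"
    "p (\<gamma>_error (real n * h) (\<gamma>_prev n)) \<le> L * error_bound n" "\<gamma>_prev n \<in> carrier_vec s"
    by blast+
  with assms step show "scheme n \<in> \<Omega>" "\<exists>!w. stage_solution s A h (scheme n) (\<gamma>_prev (Suc n)) w"
    by blast+
qed

end

end

section \<open>The tube around the exact solution\<close>

lemma compact_tube:
  fixes u :: "real \<Rightarrow> real"
  assumes "continuous_on {a..b} u"
  shows "compact {u t + v | t v. t \<in> {a..b} \<and> \<bar>v\<bar> \<le> r}"
proof -
  have "{u t + v | t v. t \<in> {a..b} \<and> \<bar>v\<bar> \<le> r} = (\<lambda>z. u (fst z) + snd z) ` ({a..b} \<times> {-r..r})"
    by (force simp: abs_le_iff image_iff)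
  moreover have "compact \<dots>"
    by (intro compact_continuous_image compact_Times compact_Icc continuous_intros
        continuous_on_compose2[OF assms]) auto
  ultimately show ?thesis by simp
qed

text \<open>The bound for the error of \<open>u\<close> is needed slightly beyond \<open>T\<close>, because a step that starts before \<open>T\<close> may end
  after it. The tube over \<open>[0, T]\<close> is compact, hence has positive distance \<open>\<delta>\<close> from the complement of
  \<open>\<Omega>\<close>, and \<open>u\<close> moves by less than \<open>\<delta>\<close> on a short time interval after \<open>T\<close>.\<close>

lemma tube_extension:
  fixes u :: "real \<Rightarrow> real" and Tlow Tup :: ereal
  assumes "open \<Omega>" and "Tlow < 0" "0 < T" "ereal T < Tup"
    and cont: "\<And>t. t \<in> einterval Tlow Tup \<Longrightarrow> isCont u t"
    and r: "r > 0" and tube: "{u t + v | t v. t \<in> {0..T} \<and> \<bar>v\<bar> \<le> r} \<subseteq> \<Omega>"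
  obtains \<eta> where "\<eta> > 0" "{- 2 * \<eta>..T + 2 * \<eta>} \<subseteq> einterval Tlow Tup" "ereal \<eta> < - Tlow"
    "\<And>t x. t \<in> {0..T + \<eta>} \<Longrightarrow> \<bar>u t - x\<bar> \<le> r \<Longrightarrow> x \<in> \<Omega>"
proof -
  have sub: "{0..T} \<subseteq> einterval Tlow Tup"
  proof
    fix t assume t: "t \<in> {0..T}"
    have "Tlow < ereal t"
      by (rule less_le_trans[OF \<open>Tlow < 0\<close>]) (use t in simp)
    moreover have "ereal t < Tup"
      by (rule le_less_trans[OF _ \<open>ereal T < Tup\<close>]) (use t in simp)
    ultimately show "t \<in> einterval Tlow Tup" by (simp add: einterval_def)
  qed
  then have "continuous_on {0..T} u" using cont by (meson continuous_at_imp_continuous_on subsetD)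
  from compact_tube[OF this] obtain \<delta> where \<delta>: "\<delta> > 0" "(\<Union>x\<in>{u t + v | t v. t \<in> {0..T} \<and> \<bar>v\<bar> \<le> r}. ball x \<delta>) \<subseteq> \<Omega>"
    by (rule compact_subset_open_imp_ball_epsilon_subset[OF _ \<open>open \<Omega>\<close> tube])
  have "isCont u T" using \<open>0 < T\<close> by (intro cont subsetD[OF sub]) simp
  then obtain \<eta>1 where \<eta>1: "\<eta>1 > 0" "\<And>t. dist t T < \<eta>1 \<Longrightarrow> dist (u t) (u T) < \<delta>"
    using \<delta>(1) unfolding continuous_at_eps_delta by metis
  obtain \<alpha> where \<alpha>: "Tlow < ereal \<alpha>" "ereal \<alpha> < 0" using ereal_dense2[OF \<open>Tlow < 0\<close>] by blast
  obtain \<beta> where \<beta>: "ereal T < ereal \<beta>" "ereal \<beta> < Tup" using ereal_dense2[OF \<open>ereal T < Tup\<close>] by blast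
  define \<eta> where "\<eta> = min (\<eta>1 / 2) (min (- \<alpha> / 2) ((\<beta> - T) / 2))"
  have \<alpha>0: "\<alpha> < 0" using \<alpha>(2) by simp
  have \<eta>: "\<eta> > 0" "\<eta> < \<eta>1" "\<alpha> \<le> - 2 * \<eta>" "T + 2 * \<eta> \<le> \<beta>"
    using \<eta>1(1) \<alpha>0 \<beta>(1) by (auto simp: \<eta>_def min_def field_simps)
  show thesis
  proof (rule that[OF \<eta>(1)])
    show "{- 2 * \<eta>..T + 2 * \<eta>} \<subseteq> einterval Tlow Tup"
    proof
      fix t assume "t \<in> {- 2 * \<eta>..T + 2 * \<eta>}"
      then have "\<alpha> \<le> t" "t \<le> \<beta>" using \<eta> by auto
      then have "Tlow < ereal t" "ereal t < Tup"
        by (auto intro: less_le_trans[OF \<alpha>(1)] le_less_trans[OF _ \<beta>(2)])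
      then show "t \<in> einterval Tlow Tup" by (simp add: einterval_def)
    qed
    have "ereal \<eta> < ereal (- \<alpha>)" using \<eta> by simp
    also have "ereal (- \<alpha>) < - Tlow" using \<alpha>(1) by (metis ereal_minus_less_minus uminus_ereal.simps(1))
    finally show "ereal \<eta> < - Tlow" .
    fix t x assume t: "t \<in> {0..T + \<eta>}" and x: "\<bar>u t - x\<bar> \<le> r"
    \<comment> \<open>The point \<open>x\<close> is moved to the tube over \<open>[0, T]\<close>, over the nearest time in that interval.\<close>
    define t' where "t' = min t T"
    have "u t' + (x - u t) \<in> {u t + v | t v. t \<in> {0..T} \<and> \<bar>v\<bar> \<le> r}"
      using t x \<open>0 < T\<close> by (intro CollectI exI[of _ t'] exI[of _ "x - u t"]) (auto simp: t'_def abs_minus_commute)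
    moreover have "x \<in> ball (u t' + (x - u t)) \<delta>"
    proof (cases "t \<le> T")
      case False
      then have "dist t T < \<eta>1" using t \<eta> by (auto simp: dist_real_def)
      then show ?thesis using \<eta>1(2)[of t] False by (auto simp: t'_def dist_real_def)
    qed (use \<delta> in \<open>auto simp: t'_def\<close>)
    ultimately show "x \<in> \<Omega>" using \<delta>(2) by blast
  qed
qed

text \<open>The points \<open>x\<close> and \<open>u t\<close> span a segment inside the tube, and \<open>N'\<close> is bounded on the tube by compactness.\<close>

lemma lipschitz_in_tube:
  fixes u :: "real \<Rightarrow> real"
  assumes N: "smooth_on_open \<Omega> N" and u: "continuous_on {0..T'} u"
    and tube: "\<And>t x. t \<in> {0..T'} \<Longrightarrow> \<bar>u t - x\<bar> \<le> r \<Longrightarrow> x \<in> \<Omega>"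
  obtains \<Lambda> where "\<Lambda> \<ge> 0"
    "\<And>t x. t \<in> {0..T'} \<Longrightarrow> \<bar>u t - x\<bar> \<le> r \<Longrightarrow> \<bar>N x - N (u t)\<bar> \<le> \<Lambda> * \<bar>u t - x\<bar>"
proof -
  define W where "W = {u t + v | t v. t \<in> {0..T'} \<and> \<bar>v\<bar> \<le> r}"
  have W_iff: "x \<in> W \<longleftrightarrow> (\<exists>t\<in>{0..T'}. \<bar>u t - x\<bar> \<le> r)" for x
  proof
    assume "\<exists>t\<in>{0..T'}. \<bar>u t - x\<bar> \<le> r"
    then obtain t where "t \<in> {0..T'}" "\<bar>u t - x\<bar> \<le> r" by blast
    then show "x \<in> W"
      unfolding W_def by (intro CollectI exI[of _ t] exI[of _ "x - u t"]) auto
  qed (force simp: W_def)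
  have W: "compact W" "W \<subseteq> \<Omega>"
    unfolding W_def using compact_tube[OF u] tube W_iff unfolding W_def by blast+
  have diff: "(deriv ^^ k) N differentiable (at x)" if "x \<in> \<Omega>" for k x
    using N that unfolding smooth_on_open_def by (metis at_within_open differentiable_on_def)
  have "continuous_on W (deriv N)"
    using diff[of _ 1] W(2)
    by (intro continuous_at_imp_continuous_on ballI differentiable_imp_continuous_within) auto
  then obtain \<Lambda> where \<Lambda>: "\<Lambda> \<ge> 0" "\<And>x. x \<in> W \<Longrightarrow> norm (deriv N x) \<le> \<Lambda>"
    using continuous_on_compact_bound[OF W(1)] by metis
  show thesis
  proof (rule that[OF \<Lambda>(1)])
    fix t x assume t: "t \<in> {0..T'}" and x: "\<bar>u t - x\<bar> \<le> r"
    have "norm (N x - N (u t)) \<le> \<Lambda> * norm (x - u t)"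
    proof (rule field_differentiable_bound[of "cball (u t) r" N "deriv N"])
      fix z assume "z \<in> cball (u t) r"
      then have z: "z \<in> W" using t unfolding W_iff by (auto simp: dist_real_def)
      have "N differentiable (at z)" using diff[of z 0] z W(2) by auto
      then show "(N has_field_derivative deriv N z) (at z within cball (u t) r)"
        using DERIV_deriv_iff_real_differentiable has_field_derivative_at_within by blast
      show "norm (deriv N z) \<le> \<Lambda>" by (rule \<Lambda>(2)[OF z])
    qed (use x in \<open>auto simp: dist_real_def\<close>)
    then show "\<bar>N x - N (u t)\<bar> \<le> \<Lambda> * \<bar>u t - x\<bar>" by (simp add: abs_minus_commute)
  qed
qed

section \<open>Convergence\<close>

theorem theorem9:
  fixes \<Omega> V :: "real set" and N u :: "real \<Rightarrow> real" and u_init T r M m :: real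
    and Tlow Tup :: ereal
    and s :: nat and c b \<theta> :: "real vec" and A D :: "real mat"
  assumes "open \<Omega>"
    and "smooth_on_open \<Omega> N"
    and "u_init \<in> \<Omega>"
    and "maximal_ode_solution \<Omega> N u_init Tlow Tup u"
    and "0 < T" and "ereal T < Tup"
    and "s \<ge> 1"
    and "rk_collocation s c A b"
    and "D \<in> carrier_mat s s" and "\<theta> \<in> carrier_vec s"
    and "strongly_stable_step D"
    and "step_of_order s c D \<theta>"
    and "r > 0"
    and "V = {u t + v | t v. t \<in> {0..T} \<and> \<bar>v\<bar> \<le> r}"
    and "V \<subseteq> \<Omega>"
    and "M = (SUP t\<in>{0..T}. \<bar>N (u t)\<bar>)"
    and "m > 0"
    and "M + m > (SUP v\<in>V. \<bar>N v\<bar>)"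
  shows "\<exists>C h0. C > 0 \<and> h0 > 0 \<and> ereal h0 < - Tlow \<and> C * exp (C * T) * h0 ^ s < min r m \<and>
    (\<forall>h. 0 < h \<and> h < h0 \<longrightarrow> (\<forall>u0 \<in> \<Omega>. \<forall>g0 \<in> carrier_vec s.
      (\<forall>i<s. g0 $ i \<in> N ` V) \<and>
      exp (C * T) * (\<bar>u_init - u0\<bar> + C * (gamma_init_error s N u c h g0 + h0 ^ s)) < r \<and>
      C * exp (C * T) * (\<bar>u_init - u0\<bar> + gamma_init_error s N u c h g0 + h0 ^ s) < m
      \<longrightarrow>
      (\<forall>n::nat. (real n - 1) * h \<le> T \<longrightarrow> scheme_well_defined \<Omega> s N A b D \<theta> h u0 g0 n) \<and>
      (\<forall>n::nat. real n * h \<le> T \<longrightarrow>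
        (\<forall>i<s. \<bar>scheme_gamma_prev s N A b D \<theta> h u0 g0 n $ i\<bar> \<le> M + m) \<and>
        (MAX k\<in>{..n}. \<bar>u (real k * h) - scheme_u s N A b D \<theta> h u0 g0 k\<bar>)
          \<le> exp (C * real n * h) *
             (\<bar>u_init - u0\<bar> + C * (gamma_init_error s N u c h g0 + h ^ s)))))"
proof -
  have ode: "Tlow < 0" "u 0 = u_init"
    and u: "\<And>t. t \<in> einterval Tlow Tup \<Longrightarrow> u t \<in> \<Omega> \<and> (u has_real_derivative N (u t) * u t) (at t)"
    using assms(4) unfolding maximal_ode_solution_def ode_solution_def by auto
  have s: "s > 0" using assms(7) by simp
  have c: "\<And>i. i < s \<Longrightarrow> 0 \<le> c $ i \<and> c $ i \<le> 1"
    and c_inj: "inj_on (\<lambda>k. c $ k) {..<s}"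
    and A_eq: "\<And>i j. i < s \<Longrightarrow> j < s \<Longrightarrow> A $$ (i, j) = integral {0..c $ i} (lagrange_basis s c j)"
    and b_eq: "\<And>i. i < s \<Longrightarrow> b $ i = integral {0..1} (lagrange_basis s c i)"
    using assms(8) unfolding rk_collocation_def
    by (blast, (intro inj_onI, metis lessThan_iff linorder_neqE_nat less_irrefl), blast+)
  have cont: "isCont u t" if "t \<in> einterval Tlow Tup" for t
    using u[OF that] by (blast intro: DERIV_isCont)
  have V_sub: "{u t + v | t v. t \<in> {0..T} \<and> \<bar>v\<bar> \<le> r} \<subseteq> \<Omega>"
    using assms(14,15) by simp
  obtain \<eta> where \<eta>: "\<eta> > 0" and sub: "{- 2 * \<eta>..T + 2 * \<eta>} \<subseteq> einterval Tlow Tup"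
    and \<eta>_Tlow: "ereal \<eta> < - Tlow"
    and tube: "\<And>t x. t \<in> {0..T + \<eta>} \<Longrightarrow> \<bar>u t - x\<bar> \<le> r \<Longrightarrow> x \<in> \<Omega>"
    by (rule tube_extension[OF assms(1) ode(1) assms(5,6) cont assms(13) V_sub]) (assumption, (rule that; blast))
  define J where "J = {- 2 * \<eta>..T + 2 * \<eta>}"
  define T' where "T' = T + \<eta>"
  have T': "0 < T'" "T < T'" using \<eta> assms(5) by (auto simp: T'_def)
  have T'_sub: "{0..T'} \<subseteq> J" using \<eta> by (auto simp: J_def T'_def)
  have cont_u: "continuous_on I u" if "I \<subseteq> J" for I
    by (intro continuous_at_imp_continuous_on ballI cont) (use that sub in \<open>auto simp: J_def\<close>)
  have N_diff: "times_differentiable k \<Omega> N" for k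
    using smooth_on_open_imp_times_differentiable[OF assms(2), of k 0] by simp
  have field: "times_differentiable k \<Omega> (\<lambda>x. N x * x)" for k
    by (intro times_differentiable_mult N_diff times_differentiable_ident)
  \<comment> \<open>Towers for \<open>u\<close> and \<open>N \<circ> u\<close>, one level higher than Taylor's theorem requires: the extra
    derivative makes the top level continuous, hence bounded on the compact interval \<open>J\<close>.\<close>
  obtain F where F: "F 0 = (\<lambda>x. x) \<circ> u" "derivative_tower (Suc (Suc s)) J F"
  proof -
    obtain F where "F 0 = (\<lambda>x. x) \<circ> u" and F: "derivative_tower (Suc (Suc s)) (einterval Tlow Tup) F"
      using derivative_tower_along_flow[of "einterval Tlow Tup" u \<Omega>, OF u field times_differentiable_ident] by blast
    then show thesis using that[OF _ derivative_tower_mono[OF F order_refl]] sub by (simp add: J_def)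
  qed
  have F0: "F 0 t = u t" for t by (simp add: F(1))
  have F1: "F 1 t = N (u t) * u t" if "t \<in> J" for t
  proof (rule DERIV_unique)
    show "(u has_real_derivative N (u t) * u t) (at t)" using u sub that unfolding J_def by blast
    have "(F 0 has_real_derivative F 1 t) (at t)" using F(2) that by (simp add: derivative_tower_def)
    then show "(u has_real_derivative F 1 t) (at t)" by (simp add: F(1) comp_def)
  qed
  obtain H where H: "H 0 = N \<circ> u" "derivative_tower (Suc s) J H"
  proof -
    obtain F where "F 0 = N \<circ> u" and F: "derivative_tower (Suc s) (einterval Tlow Tup) F"
      using derivative_tower_along_flow[of "einterval Tlow Tup" u \<Omega>, OF u field N_diff] by blast
    then show thesis using that[OF _ derivative_tower_mono[OF F order_refl]] sub by (simp add: J_def)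
  qed
  have H0: "H 0 t = N (u t)" for t by (simp add: H(1))
  obtain BF where BF: "\<And>t. t \<in> J \<Longrightarrow> \<bar>F (Suc s) t\<bar> \<le> BF"
    by (rule derivative_tower_bounded[OF F(2)[unfolded J_def]]) (rule that, simp add: J_def)
  obtain BH where BH: "\<And>t. t \<in> J \<Longrightarrow> \<bar>H s t\<bar> \<le> BH"
    by (rule derivative_tower_bounded[OF H(2)[unfolded J_def]]) (rule that, simp add: J_def)
  obtain R where R: "R \<ge> 0" "\<And>t. t \<in> J \<Longrightarrow> \<bar>u t\<bar> \<le> R"
    using derivative_tower_bounded[OF derivative_tower_mono[OF F(2) _ order_refl, of "Suc 0", unfolded J_def]]
    unfolding F0 J_def by auto
  obtain M' where M': "M' \<ge> 0" "\<And>t. t \<in> J \<Longrightarrow> \<bar>N (u t)\<bar> \<le> M'"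
    using derivative_tower_bounded[OF derivative_tower_mono[OF H(2) _ order_refl, of "Suc 0", unfolded J_def]]
    unfolding H0 J_def by auto
  obtain \<Lambda> where \<Lambda>: "\<Lambda> \<ge> 0"
    "\<And>t x. t \<in> {0..T'} \<Longrightarrow> \<bar>u t - x\<bar> \<le> r \<Longrightarrow> \<bar>N x - N (u t)\<bar> \<le> \<Lambda> * \<bar>u t - x\<bar>"
    by (rule lipschitz_in_tube[OF assms(2) cont_u[OF T'_sub] tube[folded T'_def]])
      (assumption, assumption, (rule that; blast))
  have F': "derivative_tower (Suc s) {- 2 * \<eta>..T + 2 * \<eta>} F"
    by (rule derivative_tower_mono[OF F(2)]) (auto simp: J_def)
  have H': "derivative_tower s {- 2 * \<eta>..T + 2 * \<eta>} H"
    by (rule derivative_tower_mono[OF H(2)]) (auto simp: J_def)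
  obtain k1 where k1: "k1 \<ge> 0" "\<And>t h i. 0 < h \<Longrightarrow> - 2 * \<eta> \<le> t - h \<Longrightarrow> t + h \<le> T + 2 * \<eta> \<Longrightarrow> i < s \<Longrightarrow>
     \<bar>N (u (t + c $ i * h)) - ((\<Sum>j<s. D $$ (i, j) * N (u (t - h + c $ j * h))) + N (u t) * \<theta> $ i)\<bar> \<le> k1 * h ^ s"
    using step_consistency[OF assms(12,9) s c H' BH[unfolded J_def]] unfolding H0 by auto
  obtain k2 where k2: "k2 \<ge> 0" "\<And>x t h. x \<in> {0..1} \<Longrightarrow> 0 < h \<Longrightarrow> - 2 * \<eta> \<le> t \<Longrightarrow> t + h \<le> T + 2 * \<eta> \<Longrightarrow>
     \<bar>u (t + x * h) - (u t + h * (\<Sum>j<s. integral {0..x} (lagrange_basis s c j) * F 1 (t + c $ j * h)))\<bar>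
       \<le> k2 * h ^ Suc s"
    using collocation_consistency[OF c_inj s c F' BF[unfolded J_def]] unfolding F0 by auto
  obtain q \<kappa> p where q: "0 < q" "q < 1" and \<kappa>: "\<kappa> \<ge> (1::real)" and p: "adapted_norm s D q \<kappa> p"
    using adapted_norm_exists[OF assms(9) s assms(11)] by blast
  define a where "a = (\<Sum>i<s. \<Sum>j<s. \<bar>A $$ (i, j)\<bar>) + (\<Sum>j<s. \<bar>b $ j\<bar>)"
  have a: "(\<Sum>j<s. \<bar>b $ j\<bar>) \<le> a" "\<And>i. i < s \<Longrightarrow> (\<Sum>j<s. \<bar>A $$ (i, j)\<bar>) \<le> a" "0 \<le> a"
  proof -
    have *: "0 \<le> (\<Sum>i<s. \<Sum>j<s. \<bar>A $$ (i, j)\<bar>)" "0 \<le> (\<Sum>j<s. \<bar>b $ j\<bar>)" by (auto intro: sum_nonneg)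
    show "(\<Sum>j<s. \<bar>b $ j\<bar>) \<le> a" "0 \<le> a" using * by (auto simp: a_def)
    show "(\<Sum>j<s. \<bar>A $$ (i, j)\<bar>) \<le> a" if "i < s" for i
    proof -
      have "(\<Sum>j<s. \<bar>A $$ (i, j)\<bar>) \<le> (\<Sum>i<s. \<Sum>j<s. \<bar>A $$ (i, j)\<bar>)"
        using that by (intro member_le_sum[of i "{..<s}" "\<lambda>i. \<Sum>j<s. \<bar>A $$ (i, j)\<bar>"]) (auto intro: sum_nonneg)
      then show ?thesis using * unfolding a_def by linarith
    qed
  qed
  define \<tau> where "\<tau> = (\<Sum>i<s. \<bar>\<theta> $ i\<bar>)"
  have \<tau>: "0 \<le> \<tau>" "\<And>i. i < s \<Longrightarrow> \<bar>\<theta> $ i\<bar> \<le> \<tau>"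
    unfolding \<tau>_def by (auto intro!: sum_nonneg member_le_sum[of _ "{..<s}" "\<lambda>i. \<bar>\<theta> $ i\<bar>"])
  \<comment> \<open>The exact coefficients are bounded by \<open>M'\<close>, and the errors of the computed ones
    stay below \<open>m\<close>.\<close>
  define K where "K = M' + m"
  have K: "0 \<le> K" using M' assms(17) by (simp add: K_def)
  \<comment> \<open>The fixed point of \<open>L \<mapsto> q L + \<kappa> (\<tau> \<Lambda> + k1)\<close>, increased by \<open>\<kappa>\<close>.\<close>
  define L where "L = \<kappa> + \<kappa> * (\<tau> * \<Lambda> + k1) / (1 - q)"
  have E0: "0 \<le> \<kappa> * (\<tau> * \<Lambda> + k1)" using \<kappa> \<tau> \<Lambda>(1) k1(1) by auto
  have L: "\<kappa> \<le> L" "q * L + \<kappa> * (\<tau> * \<Lambda> + k1) \<le> L"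
  proof -
    show "\<kappa> \<le> L" using E0 q by (simp add: L_def)
    have "(1 - q) * L = (1 - q) * \<kappa> + \<kappa> * (\<tau> * \<Lambda> + k1)"
    proof -
      have "(1 - q) * (\<kappa> + x / (1 - q)) = (1 - q) * \<kappa> + x" for x using q by (simp add: distrib_left)
      then show ?thesis unfolding L_def .
    qed
    moreover have "0 \<le> (1 - q) * \<kappa>" using q \<kappa> by auto
    ultimately show "q * L + \<kappa> * (\<tau> * \<Lambda> + k1) \<le> L" by (simp add: algebra_simps)
  qed
  have L0: "0 \<le> L" using L \<kappa> by linarith
  define gr where "gr = 2 * a * K + 2 * a * R * L + 2 * k2"
  have gr: "0 \<le> gr" using a K R L0 k2 by (auto simp: gr_def)
  \<comment> \<open>The factor \<open>T' / T\<close> makes \<open>e\<^bsup>C T\<^esup>\<close> dominate the growth up to \<open>T' > T\<close>.\<close>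
  define C where "C = gr * (T' / T) + L + 1"
  have C: "gr * T' \<le> C * T" "L \<le> C" "1 \<le> C" "gr \<le> C"
  proof -
    have "C * T = gr * T' + (L + 1) * T" using assms(5) by (simp add: C_def field_simps)
    then show "gr * T' \<le> C * T" using L0 assms(5) by auto
    have "1 \<le> T' / T" using T' assms(5) by simp
    then have "gr * 1 \<le> gr * (T' / T)" using gr by (intro mult_left_mono)
    then show "L \<le> C" "1 \<le> C" "gr \<le> C" using L0 gr by (auto simp: C_def)
  qed
  \<comment> \<open>In this order: the node times stay where \<open>u\<close> is controlled, \<open>h0\<^sup>s \<le> h0\<close>, the stage system
    contracts, and \<open>C e\<^bsup>C T\<^esup> h0\<close> is at most half of \<open>min r m\<close>.\<close>
  define h0 where "h0 = min (min \<eta> 1) (min (1 / (2 * (a * K + 1))) (min r m / (2 * (C * exp (C * T)))))"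
  have rm: "0 < min r m" using assms(13,17) by simp
  have aK: "0 \<le> a * K" using a K by simp
  have h0: "0 < h0" "h0 \<le> \<eta>" "h0 \<le> 1" "h0 \<le> 1 / (2 * (a * K + 1))"
      "h0 \<le> min r m / (2 * (C * exp (C * T)))"
    using \<eta> aK rm C(3) unfolding h0_def by (auto simp: add_nonneg_pos)
  have h0_C: "C * exp (C * T) * h0 ^ s < min r m"
  proof -
    have "h0 ^ s \<le> h0 ^ 1" using h0 s by (intro power_decreasing) auto
    then have "C * exp (C * T) * h0 ^ s \<le> C * exp (C * T) * (min r m / (2 * (C * exp (C * T))))"
      using h0(5) C(3) by (intro mult_left_mono) auto
    also have "\<dots> = min r m / 2" using C(3) by simp
    also have "\<dots> < min r m" using rm by linarith
    finally show ?thesis .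
  qed
  have h0_Tlow: "ereal h0 < - Tlow" using h0(2) \<eta>_Tlow by (meson ereal_less_eq(3) le_less_trans)
  show ?thesis
  proof (rule exI[of _ C], rule exI[of _ h0], intro conjI allI impI ballI)
    show "C > 0" using C(3) by simp
    show "h0 > 0" "ereal h0 < - Tlow" "C * exp (C * T) * h0 ^ s < min r m" by fact+
  next
    fix h u0 g0
    assume h_range: "0 < h \<and> h < h0" and u0: "u0 \<in> \<Omega>" and g0: "g0 \<in> carrier_vec s"
      and start: "(\<forall>i<s. g0 $ i \<in> N ` V) \<and>
        exp (C * T) * (\<bar>u_init - u0\<bar> + C * (gamma_init_error s N u c h g0 + h0 ^ s)) < r \<and>
        C * exp (C * T) * (\<bar>u_init - u0\<bar> + gamma_init_error s N u c h g0 + h0 ^ s) < m"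
    from h_range have h: "0 < h" "h < h0" by auto
    from start have g0_V: "\<forall>i<s. g0 $ i \<in> N ` V"
      and small_r: "exp (C * T) * (\<bar>u_init - u0\<bar> + C * (gamma_init_error s N u c h g0 + h0 ^ s)) < r"
      and small_m: "C * exp (C * T) * (\<bar>u_init - u0\<bar> + gamma_init_error s N u c h g0 + h0 ^ s) < m"
      by blast+
    define \<epsilon>0 where "\<epsilon>0 = gamma_init_error s N u c h g0"
    have \<epsilon>0: "\<forall>i<s. \<bar>g0 $ i - N (u (- h + c $ i * h))\<bar> \<le> \<epsilon>0"
      unfolding \<epsilon>0_def gamma_init_error_def by (intro allI impI Max_ge) auto
    then have \<epsilon>0_nonneg: "0 \<le> \<epsilon>0" using s abs_ge_zero order_trans by blast
    have ch: "0 \<le> c $ j * h" "c $ j * h \<le> h" if "j < s" for j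
      using c[OF that] h(1) by (auto simp: mult_left_le_one_le)
    have tJ: "t + c $ j * h \<in> J" "- 2 * \<eta> \<le> t - h" "- 2 * \<eta> \<le> t" "t + h \<le> T + 2 * \<eta>"
      if "t \<in> {0..T'}" "j < s" for t j
      using that ch[OF that(2)] h h0(2) \<eta> unfolding J_def T'_def atLeastAtMost_iff by linarith+
    interpret S: consistent_scheme \<Omega> N u s c b \<theta> A D p q \<kappa> h T' r a \<tau> \<Lambda> M' K R k1 k2 L
    proof unfold_locales
      show "h * a * K \<le> 1 / 2"
      proof -
        have "h * (a * K) \<le> (1 / (2 * (a * K + 1))) * (a * K)"
          using h h0(4) aK by (intro mult_right_mono) auto
        also have "\<dots> \<le> 1 / 2" using aK by (simp add: field_simps add_nonneg_pos)
        finally show ?thesis by (simp add: mult.assoc)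
      qed
      show "x \<in> \<Omega> \<and> \<bar>N x - N (u t)\<bar> \<le> \<Lambda> * \<bar>u t - x\<bar>" if "t \<in> {0..T'}" "\<bar>u t - x\<bar> < r" for t x
        using \<Lambda>(2)[OF that(1), of x] tube[of t x] that by (auto simp: T'_def)
      show "\<bar>u (t + c $ i * h) - (u t + h * (\<Sum>j<s. A $$ (i, j) * (N (u (t + c $ j * h)) * u (t + c $ j * h))))\<bar>
          \<le> k2 * h ^ Suc s" if t: "t \<in> {0..T'}" and i: "i < s" for t i
      proof -
        have "(\<Sum>j<s. A $$ (i, j) * (N (u (t + c $ j * h)) * u (t + c $ j * h)))
            = (\<Sum>j<s. integral {0..c $ i} (lagrange_basis s c j) * F 1 (t + c $ j * h))"
          using F1[OF tJ(1)[OF t]] A_eq[OF i] by (intro sum.cong) simp_all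
        then show ?thesis using k2(2)[of "c $ i" h t] c[OF i] tJ[OF t i] h(1) by simp
      qed
      show "\<bar>u (t + h) - (u t + h * (\<Sum>j<s. b $ j * (N (u (t + c $ j * h)) * u (t + c $ j * h))))\<bar>
          \<le> k2 * h ^ Suc s" if t: "t \<in> {0..T'}" for t
      proof -
        have "(\<Sum>j<s. b $ j * (N (u (t + c $ j * h)) * u (t + c $ j * h)))
            = (\<Sum>j<s. integral {0..1} (lagrange_basis s c j) * F 1 (t + c $ j * h))"
          using F1[OF tJ(1)[OF t]] b_eq by (intro sum.cong) simp_all
        then show ?thesis using k2(2)[of 1 h t] tJ[OF t s] h(1) by simp
      qed
      show "\<bar>N (u (t + c $ i * h)) - ((\<Sum>j<s. D $$ (i, j) * N (u (t - h + c $ j * h))) + N (u t) * \<theta> $ i)\<bar>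
          \<le> k1 * h ^ s" if "t \<in> {0..T'}" "i < s" for t i
        using k1(2)[OF h(1) tJ(2)[OF that] tJ(4)[OF that] that(2)] .
      show "\<bar>N (u (t + c $ j * h))\<bar> \<le> M'" "\<bar>u (t + c $ j * h)\<bar> \<le> R" if "t \<in> {0..T'}" "j < s" for t j
        using M'(2) R(2) tJ(1)[OF that] by auto
    qed (fact s assms(9,10) h(1) p a \<tau>(2) L \<Lambda>(1) K R(1) k1(1) k2(1) | use q \<kappa> in simp)+
    have growth: "S.growth = gr" by (simp add: S.growth_def gr_def)
    define \<epsilon> where "\<epsilon> = \<bar>u 0 - u0\<bar> + \<epsilon>0 + h ^ s"
    have \<epsilon>: "0 \<le> \<epsilon>" using \<epsilon>0_nonneg h by (simp add: \<epsilon>_def)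
    have hs: "h ^ s \<le> h0 ^ s" using h by (intro power_mono) auto
    have exp_le: "exp (gr * T') * \<epsilon> \<le> exp (C * T) * \<epsilon>" using C(1) \<epsilon> by (intro mult_right_mono) auto
    have r_bound: "exp (gr * T') * \<epsilon> < r"
    proof -
      have "1 * (\<epsilon>0 + h ^ s) \<le> C * (\<epsilon>0 + h0 ^ s)"
        using C(3) hs \<epsilon>0_nonneg h by (intro mult_mono) auto
      then have "exp (C * T) * \<epsilon> \<le> exp (C * T) * (\<bar>u_init - u0\<bar> + C * (\<epsilon>0 + h0 ^ s))"
        by (intro mult_left_mono) (auto simp: \<epsilon>_def ode(2))
      then show ?thesis using exp_le small_r unfolding \<epsilon>0_def by linarith
    qed
    have m_bound: "L * (exp (gr * T') * \<epsilon>) < m"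
    proof -
      have "L * (exp (gr * T') * \<epsilon>) \<le> C * (exp (C * T) * (\<bar>u_init - u0\<bar> + \<epsilon>0 + h0 ^ s))"
        using C(2) L0 \<epsilon> hs
        by (intro mult_mono order_trans[OF exp_le] mult_left_mono) (auto simp: \<epsilon>_def ode(2))
      then show ?thesis using small_m unfolding \<epsilon>0_def by (simp add: mult.assoc)
    qed
    have M'_bound: "M' + L * (exp (gr * T') * \<epsilon>) \<le> K" using m_bound by (simp add: K_def)
    note final = S.error_bound_le_final[OF g0 \<epsilon>0 r_bound[unfolded \<epsilon>_def, folded growth] M'_bound[unfolded \<epsilon>_def, folded growth]]
    note exp_bound = S.error_bound_le_exp[OF g0 \<epsilon>0 r_bound[unfolded \<epsilon>_def, folded growth] M'_bound[unfolded \<epsilon>_def, folded growth]]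
    note scheme = S.scheme_error[OF g0 \<epsilon>0 r_bound[unfolded \<epsilon>_def, folded growth] M'_bound[unfolded \<epsilon>_def, folded growth]]
    \<comment> \<open>The last admissible index satisfies \<open>n h \<le> T + h\<close>, which is below \<open>T'\<close>.\<close>
    show "scheme_well_defined \<Omega> s N A b D \<theta> h u0 g0 n" if "(real n - 1) * h \<le> T" for n
      unfolding scheme_well_defined_def
    proof (intro allI impI)
      fix k assume "k \<le> n"
      then have "real k * h \<le> real n * h" using h by (intro mult_right_mono) auto
      also have "\<dots> \<le> T'" using that h h0(2) by (simp add: T'_def algebra_simps)
      finally show "scheme_u s N A b D \<theta> h u0 g0 k \<in> \<Omega> \<and>
        (\<exists>!w. stage_solution s A h (scheme_u s N A b D \<theta> h u0 g0 k) (scheme_gamma_prev s N A b D \<theta> h u0 g0 (Suc k)) w)"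
        using scheme(4,5) by blast
    qed
    fix n :: nat
    assume n: "real n * h \<le> T"
    then have n': "real n * h \<le> T'" using T' by linarith
    show "\<bar>scheme_gamma_prev s N A b D \<theta> h u0 g0 n $ i\<bar> \<le> M + m" if i: "i < s" for i
    proof (cases n)
      case 0
      \<comment> \<open>For \<open>n = 0\<close> the comparison times may be negative, and the bound comes from the range \<open>N ` V\<close>.\<close>
      have "continuous_on \<Omega> N"
        using assms(2) unfolding smooth_on_open_def
        by (metis differentiable_imp_continuous_on funpow_0)
      moreover have "compact V"
        using compact_tube[OF cont_u, of 0 T r] \<eta> assms(14) by (simp add: J_def)
      ultimately have "compact ((\<lambda>v. \<bar>N v\<bar>) ` V)"
        using assms(15) by (intro compact_continuous_image continuous_intros) (auto intro: continuous_on_subset)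
      then have "bdd_above ((\<lambda>v. \<bar>N v\<bar>) ` V)" by (intro bounded_imp_bdd_above compact_imp_bounded)
      moreover obtain v where v: "v \<in> V" "g0 $ i = N v" using g0_V i by auto
      ultimately have "\<bar>g0 $ i\<bar> \<le> (SUP v\<in>V. \<bar>N v\<bar>)" by (auto intro: cSUP_upper)
      then show ?thesis using 0 assms(18) by (simp add: scheme_gamma_prev_def)
    next
      case (Suc n0)
      define t where "t = real n * h - h + c $ i * h"
      \<comment> \<open>For \<open>n \<ge> 1\<close> all comparison times lie in \<open>[0, T]\<close>, where \<open>\<bar>N (u t)\<bar> \<le> M\<close>.\<close>
      have "t = real n0 * h + c $ i * h" by (simp add: t_def Suc algebra_simps)
      then have "0 \<le> t" using ch(1)[OF i] h by simp
      moreover have "t \<le> T" using n ch(2)[OF i] unfolding t_def by linarith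
      ultimately have t: "t \<in> {0..T}" by simp
      have "{0..T} \<subseteq> J" using \<eta> by (auto simp: J_def)
      then have "bdd_above ((\<lambda>t. \<bar>N (u t)\<bar>) ` {0..T})" using M'(2) by (intro bdd_aboveI2) blast
      then have "\<bar>N (u t)\<bar> \<le> M" unfolding assms(16) using t by (intro cSUP_upper)
      moreover have "\<bar>scheme_gamma_prev s N A b D \<theta> h u0 g0 n $ i - N (u t)\<bar>
          \<le> p (S.\<gamma>_error (real n * h) (scheme_gamma_prev s N A b D \<theta> h u0 g0 n))"
        using S.p_upper[OF S.\<gamma>_error_carrier i, of "real n * h" "scheme_gamma_prev s N A b D \<theta> h u0 g0 n"] i
        by (simp add: S.\<gamma>_error_def t_def)
      moreover have "\<dots> \<le> L * S.error_bound u0 \<epsilon>0 n" by (rule scheme(2)[OF n'])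
      moreover have "\<dots> \<le> L * (exp (gr * T') * \<epsilon>)"
        using final[OF n'] L0 unfolding growth \<epsilon>_def by (intro mult_left_mono)
      ultimately show ?thesis using m_bound by linarith
    qed
    show "(MAX k\<in>{..n}. \<bar>u (real k * h) - scheme_u s N A b D \<theta> h u0 g0 k\<bar>)
          \<le> exp (C * real n * h) * (\<bar>u_init - u0\<bar> + C * (gamma_init_error s N u c h g0 + h ^ s))"
    proof (rule Max.boundedI; (clarsimp)?)
      fix k assume "k \<le> n"
      then have kn: "real k * h \<le> real n * h" using h by (intro mult_right_mono) auto
      have "\<bar>u (real k * h) - scheme_u s N A b D \<theta> h u0 g0 k\<bar> \<le> S.error_bound u0 \<epsilon>0 k"
        by (rule scheme(1)[OF order_trans[OF kn n']])
      also have "\<dots> \<le> exp (gr * (real k * h)) * \<epsilon>"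
        using exp_bound by (simp add: growth \<epsilon>_def)
      also have "\<dots> \<le> exp (C * real n * h) * (\<bar>u_init - u0\<bar> + C * (\<epsilon>0 + h ^ s))"
      proof (rule mult_mono)
        have "gr * (real k * h) \<le> C * (real n * h)" using C(3,4) kn gr h by (intro mult_mono) auto
        then show "exp (gr * (real k * h)) \<le> exp (C * real n * h)" by (simp add: mult.assoc)
        have "1 * (\<epsilon>0 + h ^ s) \<le> C * (\<epsilon>0 + h ^ s)"
          using C(3) \<epsilon>0_nonneg h by (intro mult_right_mono) auto
        then show "\<epsilon> \<le> \<bar>u_init - u0\<bar> + C * (\<epsilon>0 + h ^ s)" by (simp add: \<epsilon>_def ode(2))
      qed (use \<epsilon> in auto)
      finally show "\<bar>u (real k * h) - scheme_u s N A b D \<theta> h u0 g0 k\<bar>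
          \<le> exp (C * real n * h) * (\<bar>u_init - u0\<bar> + C * (gamma_init_error s N u c h g0 + h ^ s))"
        unfolding \<epsilon>0_def .
    qed
  qed
qed

end
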